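(* Let $\mathcal{H}=\{0,1,\dots,H-1\}$ with $H<\infty$ be a set of hypotheses and $\mathcal{A}=\{1,\dots,|\mathcal{A}|\}$ with $|\mathcal{A}|<\infty$ a set of actions, each action $a$ having a constant cost $c_a\in(0,\infty)$. An unknown state $\theta\in\mathcal{H}$ has uniform prior. At each time step $n=1,2,\dots$ a decision-maker chooses an action $A_n\in\mathcal{A}$, pays $c_{A_n}$, and observes a sample $X_n$ with density $f_\theta^{A_n}$; samples are conditionally independent given $\theta$ and the actions, and all densities $f_h^a$ are known. Assume: (A1) for every $a\in\mathcal{A}$ and $i,j\in\mathcal{H}$, $D(f_i^a\|f_j^a)$ is either $0$ or strictly positive; (A2) for all $i\neq j$ in $\mathcal{H}$ there is some $a\in\mathcal{A}$ with $D(f_i^a\|f_j^a)>0$, and there is no $a$ with $D(f_i^a\|f_j^a)=0$ for all $i,j\in\mathcal{H}$; (A3) there exists $\beta>0$ such that $\mathbb{E}_{X\sim f_i^a}\big[|\log(f_i^a(X)/f_j^a(X))|^2\big]<\beta$ for all $a\in\mathcal{A}$ and $i,j\in\mathcal{H}$. For each $h\in\mathcal{H}$ let $$\underline{\lambda}_h^*\in\arg\max_{\underline{\lambda}\in\Delta_{|\mathcal{A}|}}\frac{\min_{j\neq h}\mathbb{E}_{A\sim\underline{\lambda}}\big[D(f_h^A\|f_j^A)\big]}{\mathbb{E}_{A\sim\underline{\lambda}}[c_A]}.$$ Let $\underline{\rho}_n\in\Delta_H$ be the posterior over hypotheses, with $\underline{\rho}_0$ uniform and $\rho_n[i]=\rho_{n-1}[i]\,f_i^{a}(x)/\sum_{h\in\mathcal{H}}\rho_{n-1}[h]f_h^{a}(x)$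 when action $a=A_n$ is taken and $x=X_n$ is observed. Given $\delta\in(0,1)$, consider the policy that at each step draws $A_n\sim\underline{\lambda}^*_{h_n^*}$ (independently of everything else given $h_n^*$), where $h_n^*=\arg\max_{h\in\mathcal{H}}\rho_{n-1}[h]$ is the hypothesis with the currently largest posterior, stops at the first time $N$ at which some posterior component exceeds $1-\delta$, and declares $\hat\theta=\arg\max_h\rho_N[h]$. Then this policy satisfies $\mathbb{P}(\hat\theta\neq\theta)\le\delta$, and its expected total paid cost $\mathbb{E}\big[\sum_{n=1}^N c_{A_n}\big]$ is $\Theta(\log\frac{1}{\delta})$ as $\delta\to 0$.
   Context: $D(f\|g)$ is the Kullback–Leibler divergence; logarithms are base 2. $\Delta_n=\{\underline{x}\in\mathbb{R}^n:\underline{x}^T\underline{1}=1,\ \underline{x}\ge\underline{0}\}$ is the probability simplex, and for $\underline{\lambda}\in\Delta_{|\mathcal{A}|}$, $A\sim\underline{\lambda}$ means $\mathbb{P}(A=a)=\lambda[a]$. $\Theta(\cdot)$ is the Bachmann–Landau notation. The expectation and probability are over $\theta$ (uniform), the samples, and the randomized actions. *)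

theory Defs
  imports "HOL-Probability.Probability" "HOL-Library.Landau_Symbols"
begin

text \<open>KL divergence D(p||q) (base 2) of two densities p, q w.r.t. a base measure mu,
  via the library notion KL_divergence (note: KL_divergence b M N is D(N||M)).\<close>
definition KLD :: "'x measure \<Rightarrow> ('x \<Rightarrow> real) \<Rightarrow> ('x \<Rightarrow> real) \<Rightarrow> real" where
  "KLD \<mu> p q = KL_divergence 2 (density \<mu> (\<lambda>x. ennreal (q x))) (density \<mu> (\<lambda>x. ennreal (p x)))"

definition act_simplex :: "nat \<Rightarrow> (nat \<Rightarrow> real) set" where
  "act_simplex K = {l. (\<forall>a<K. 0 \<le> l a) \<and> (\<Sum>a<K. l a) = 1}"

definition objective ::
  "'x measure \<Rightarrow> nat \<Rightarrow> nat \<Rightarrow> (nat \<Rightarrow> nat \<Rightarrow> 'x \<Rightarrow> real) \<Rightarrow> (nat \<Rightarrow> real) \<Rightarrow> nat \<Rightarrow> (nat \<Rightarrow> real) \<Rightarrow> real" where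
  "objective \<mu> H K f c h l =
     Min {(\<Sum>a<K. l a * KLD \<mu> (f h a) (f j a)) | j. j < H \<and> j \<noteq> h} / (\<Sum>a<K. l a * c a)"

fun posterior ::
  "nat \<Rightarrow> (nat \<Rightarrow> nat \<Rightarrow> 'x \<Rightarrow> real) \<Rightarrow> nat \<Rightarrow> (nat \<Rightarrow> nat) \<Rightarrow> (nat \<Rightarrow> 'x) \<Rightarrow> nat \<Rightarrow> real" where
  "posterior H f 0 as xs i = 1 / real H"
| "posterior H f (Suc n) as xs i =
     posterior H f n as xs i * f i (as n) (xs n) /
     (\<Sum>h<H. posterior H f n as xs h * f h (as n) (xs n))"

definition argmax_post :: "nat \<Rightarrow> (nat \<Rightarrow> real) \<Rightarrow> nat" where
  "argmax_post H \<rho> = (LEAST h. h < H \<and> (\<forall>j<H. \<rho> j \<le> \<rho> h))"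

definition stop_cond ::
  "nat \<Rightarrow> (nat \<Rightarrow> nat \<Rightarrow> 'x \<Rightarrow> real) \<Rightarrow> real \<Rightarrow> (nat \<Rightarrow> nat) \<Rightarrow> (nat \<Rightarrow> 'x) \<Rightarrow> nat \<Rightarrow> bool" where
  "stop_cond H f \<delta> as xs n = (\<exists>i<H. posterior H f n as xs i > 1 - \<delta>)"

text \<open>Stopping time N (only meaningful when the stopping condition is ever met).\<close>
definition stop_time ::
  "nat \<Rightarrow> (nat \<Rightarrow> nat \<Rightarrow> 'x \<Rightarrow> real) \<Rightarrow> real \<Rightarrow> (nat \<Rightarrow> nat) \<Rightarrow> (nat \<Rightarrow> 'x) \<Rightarrow> nat" where
  "stop_time H f \<delta> as xs = (LEAST n. stop_cond H f \<delta> as xs n)"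

end

theory Submission
  imports Defs
begin

text \<open>
  Both halves work with the unnormalised posterior weights
  \<open>w i = (1 / H) * (\<Prod>k<n. f i (A k) (X k))\<close>, whose sum is the density of the samples.

  Upper bound: the expected pairwise Hellinger affinity \<open>\<Sum>i\<noteq>j. sqrt (w i * w j)\<close> shrinks by a
  constant factor per step. Pairs that contain the current maximiser \<open>h\<close> contract under
  \<open>lam h\<close>, because an optimal \<open>lam h\<close> separates \<open>h\<close> from every other hypothesis, and these
  pairs dominate the sum whether or not \<open>h\<close> is the true hypothesis. As the expected affinity
  bounds \<open>\<delta>\<close> times the probability of not having stopped, the stopping time has tails
  \<open>H * r ^ n / \<delta>\<close>, hence mean of order \<open>ln (1 / \<delta>)\<close>.

  Lower bound: stopping forces some log-likelihood ratio to exceed \<open>log 2 ((1 - \<delta>) / \<delta>)\<close>,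
  while the sum of all absolute ratios up to time \<open>n\<close> has mean at most linear in \<open>n\<close>; by
  Markov's inequality stopping before a small multiple of \<open>log 2 ((1 - \<delta>) / \<delta>)\<close> has
  probability at most \<open>1 / 2\<close>.
\<close>

subsection \<open>Hellinger affinity and posterior weights\<close>

text \<open>The obstacle is that the current maximiser may be wrong; then nothing ensures that the
  action distribution in use separates the true hypothesis from rivals other than the maximiser. The
  affinity is symmetric in its two hypotheses, so no case distinction on the truth arises. It is
  also multiplicative: a step multiplies \<open>sqrt (w i * w j)\<close> by a square root of
  densities whose integral is at most 1, and is below 1 once the densities differ on a set of
  positive measure. A one-step estimate given the past thus takes the place of concentration
  arguments for log-likelihood ratios. Unnormalised weights remove the random normaliser: the mean
  of \<open>sqrt (\<rho> i * \<rho> j)\<close> over samples is the integral of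
  \<open>sqrt (w i * w j)\<close>. Optimality of \<open>lam h\<close> enters through comparison with
  the uniform distribution, whose objective is positive by A2. In the lower bound, A3 makes the
  absolute log-likelihood ratios integrable. Since the law of the run is a density on cylinder sets,
  expectations become finite sums over action sequences of integrals over sample sequences.\<close>

definition affinity :: "'x measure \<Rightarrow> ('x \<Rightarrow> real) \<Rightarrow> ('x \<Rightarrow> real) \<Rightarrow> real" where
  "affinity \<mu> p q = (\<integral>x. sqrt (p x * q x) \<partial>\<mu>)"

lemma
  assumes p: "p \<in> borel_measurable \<mu>" "\<forall>x\<in>space \<mu>. 0 \<le> p x" "(\<integral>\<^sup>+ x. ennreal (p x) \<partial>\<mu>) = 1"
  shows density_integrable: "integrable \<mu> p"
    and density_integral: "(\<integral>x. p x \<partial>\<mu>) = 1"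
proof -
  have ae: "AE x in \<mu>. 0 \<le> p x" using p(2) by auto
  show i: "integrable \<mu> p"
    using p ae by (intro integrableI_nonneg) auto
  show "(\<integral>x. p x \<partial>\<mu>) = 1"
    using p ae by (subst integral_eq_nn_integral) auto
qed

text \<open>The squared Hellinger distance, the integral of \<open>d\<close>, equals
  \<open>2 - 2 * affinity\<close>. It is nonnegative, and if it vanishes, the densities agree almost
  everywhere; then the two measures coincide and their divergence is 0.\<close>

lemma
  assumes p: "p \<in> borel_measurable \<mu>" "\<forall>x\<in>space \<mu>. 0 \<le> p x" "(\<integral>\<^sup>+ x. ennreal (p x) \<partial>\<mu>) = 1"
    and q: "q \<in> borel_measurable \<mu>" "\<forall>x\<in>space \<mu>. 0 \<le> q x" "(\<integral>\<^sup>+ x. ennreal (q x) \<partial>\<mu>) = 1"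
  shows affinity_integrable: "integrable \<mu> (\<lambda>x. sqrt (p x * q x))"
    and affinity_nonneg: "0 \<le> affinity \<mu> p q"
    and affinity_le_1: "affinity \<mu> p q \<le> 1"
    and affinity_less_1: "KLD \<mu> p q \<noteq> 0 \<Longrightarrow> affinity \<mu> p q < 1"
proof -
  note [measurable] = p(1) q(1)
  note ip = density_integrable[OF p] density_integral[OF p]
  note iq = density_integrable[OF q] density_integral[OF q]
  show int: "integrable \<mu> (\<lambda>x. sqrt (p x * q x))"
  proof (rule Bochner_Integration.integrable_bound)
    show "integrable \<mu> (\<lambda>x. (p x + q x) / 2)" using ip iq by simp
    show "AE x in \<mu>. norm (sqrt (p x * q x)) \<le> norm ((p x + q x) / 2)"
      using p(2) q(2) arith_geo_mean_sqrt[of "p x" "q x" for x]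
      by (intro AE_I2) fastforce
  qed simp
  show "0 \<le> affinity \<mu> p q"
    unfolding affinity_def using p(2) q(2) by (intro integral_nonneg_AE) auto
  define d where "d x = (sqrt (p x) - sqrt (q x))\<^sup>2" for x
  have d_eq: "d x = p x + q x - 2 * sqrt (p x * q x)" if "x \<in> space \<mu>" for x
    using that p(2) q(2) by (auto simp: d_def power2_diff real_sqrt_mult)
  have int_d: "integrable \<mu> d"
    using ip iq int by (subst Bochner_Integration.integrable_cong[OF refl d_eq]) auto
  have "(\<integral>x. d x \<partial>\<mu>) = 2 - 2 * affinity \<mu> p q"
    using ip iq int by (subst Bochner_Integration.integral_cong[OF refl d_eq]) (auto simp: affinity_def)
  moreover have "0 \<le> (\<integral>x. d x \<partial>\<mu>)" by (intro integral_nonneg_AE) (auto simp: d_def)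
  ultimately show le: "affinity \<mu> p q \<le> 1" by simp
  assume KL: "KLD \<mu> p q \<noteq> 0"
  have "affinity \<mu> p q \<noteq> 1"
  proof
    assume "affinity \<mu> p q = 1"
    with \<open>(\<integral>x. d x \<partial>\<mu>) = _\<close> have "(\<integral>x. d x \<partial>\<mu>) = 0" by simp
    then have "AE x in \<mu>. d x = 0"
      by (subst (asm) integral_nonneg_eq_0_iff_AE[OF int_d]) (auto simp: d_def)
    then have "AE x in \<mu>. ennreal (p x) = ennreal (q x)"
      by (auto simp: d_def elim!: eventually_mono)
    then have *: "density \<mu> (\<lambda>x. ennreal (p x)) = density \<mu> (\<lambda>x. ennreal (q x))"
      by (intro density_cong) auto
    have "prob_space (density \<mu> (\<lambda>x. ennreal (q x)))"
      using q by (intro prob_spaceI) (simp add: emeasure_density cong: nn_integral_cong_simp)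
    then interpret Q: prob_space "density \<mu> (\<lambda>x. ennreal (q x))" .
    show False using KL Q.KL_same_eq_0 unfolding KLD_def * by simp
  qed
  with le show "affinity \<mu> p q < 1" by simp
qed

text \<open>The action probabilities are left out: given the past they are the same under every
  hypothesis and cancel in the posterior. They are collected in
  \<open>policy_weight\<close>.\<close>

definition weight ::
  "nat \<Rightarrow> (nat \<Rightarrow> nat \<Rightarrow> 'x \<Rightarrow> real) \<Rightarrow> nat \<Rightarrow> (nat \<Rightarrow> nat) \<Rightarrow> (nat \<Rightarrow> 'x) \<Rightarrow> nat \<Rightarrow> real" where
  "weight H f n as xs i = 1 / real H * (\<Prod>k<n. f i (as k) (xs k))"

lemma weight_0 [simp]: "weight H f 0 as xs i = 1 / real H"
  and weight_Suc [simp]: "weight H f (Suc n) as xs i = weight H f n as xs i * f i (as n) (xs n)"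
  by (simp_all add: weight_def)

lemma weight_nonneg:
  assumes "\<And>k. k < n \<Longrightarrow> 0 \<le> f i (as k) (xs k)"
  shows "0 \<le> weight H f n as xs i"
  using assms by (auto simp: weight_def intro!: prod_nonneg divide_nonneg_nonneg)

lemma weight_pos:
  assumes "0 < H" "\<And>k. k < n \<Longrightarrow> 0 < f i (as k) (xs k)"
  shows "0 < weight H f n as xs i"
  using assms by (auto simp: weight_def intro!: prod_pos divide_pos_pos)

text \<open>If all weights vanish, both sides are 0 by the convention \<open>x / 0 = 0\<close>.\<close>

lemma posterior_eq_weight:
  assumes "\<And>h k. h < H \<Longrightarrow> k < n \<Longrightarrow> 0 \<le> f h (as k) (xs k)" "i < H"
  shows "posterior H f n as xs i = weight H f n as xs i / (\<Sum>h<H. weight H f n as xs h)"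
  using assms
proof (induction n arbitrary: i)
  case 0
  then show ?case by simp
next
  case (Suc n)
  define W where "W = weight H f n as xs"
  define s where "s = (\<Sum>h<H. W h)"
  have IH: "posterior H f n as xs h = W h / s" if "h < H" for h
    using Suc that by (simp add: W_def s_def)
  have eq: "posterior H f (Suc n) as xs i =
      (W i / s * f i (as n) (xs n)) / ((\<Sum>h<H. W h * f h (as n) (xs n)) / s)"
    using Suc.prems by (simp add: IH sum_divide_distrib)
  show ?case
  proof (cases "s = 0")
    case True
    have "W h = 0" if "h < H" for h
    proof -
      have "\<forall>h\<in>{..<H}. W h = 0"
        using True Suc.prems unfolding s_def W_def
        by (subst sum_nonneg_eq_0_iff[symmetric]) (auto intro!: weight_nonneg)
      with that show ?thesis by auto
    qed
    with Suc.prems eq show ?thesis by (simp add: W_def)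
  next
    case False
    with eq show ?thesis by (simp add: W_def)
  qed
qed

text \<open>Actions and samples are total functions, whereas elements of \<open>acts n\<close> and
  \<open>P n\<close> are \<open>undefined\<close> from index \<open>n\<close> on. Locality lets the
  same expression be read on runs, on truncated paths and on paths updated at
  \<open>n\<close>.\<close>

lemma posterior_cong:
  assumes "\<And>k. k < n \<Longrightarrow> as k = as' k" "\<And>k. k < n \<Longrightarrow> xs k = xs' k"
  shows "posterior H f n as xs = posterior H f n as' xs'"
  using assms
proof (induction n)
  case (Suc n)
  then have "posterior H f n as xs = posterior H f n as' xs'" by simp
  with Suc.prems show ?case by (intro ext) simp
qed (auto intro!: ext)

lemma stop_cond_cong:
  assumes "\<And>k. k < n \<Longrightarrow> as k = as' k" "\<And>k. k < n \<Longrightarrow> xs k = xs' k"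
  shows "stop_cond H f \<delta> as xs n = stop_cond H f \<delta> as' xs' n"
  unfolding stop_cond_def using posterior_cong[OF assms] by simp

lemma weight_cong:
  assumes "\<And>k. k < n \<Longrightarrow> as k = as' k" "\<And>k. k < n \<Longrightarrow> xs k = xs' k"
  shows "weight H f n as xs = weight H f n as' xs'"
  using assms by (intro ext) (simp add: weight_def)

section \<open>The maximiser of the posterior\<close>

lemma
  fixes \<rho> :: "nat \<Rightarrow> real"
  assumes "0 < H"
  shows argmax_post_less: "argmax_post H \<rho> < H"
    and argmax_post_ge: "j < H \<Longrightarrow> \<rho> j \<le> \<rho> (argmax_post H \<rho>)"
proof -
  have "\<exists>h. h < H \<and> (\<forall>j<H. \<rho> j \<le> \<rho> h)"
  proof -
    have "Max (\<rho> ` {..<H}) \<in> \<rho> ` {..<H}" using assms by (intro Max_in) auto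
    then obtain h where "h < H" "\<rho> h = Max (\<rho> ` {..<H})" by auto
    then show ?thesis by (intro exI[of _ h]) auto
  qed
  from LeastI_ex[OF this] show "argmax_post H \<rho> < H" "j < H \<Longrightarrow> \<rho> j \<le> \<rho> (argmax_post H \<rho>)"
    by (auto simp: argmax_post_def)
qed

text \<open>Posteriors are the weights divided by a common nonnegative sum, so the order is kept; if
  the sum is 0, all weights are 0.\<close>

lemma weight_le_argmax:
  assumes "\<And>h k. h < H \<Longrightarrow> k < n \<Longrightarrow> 0 \<le> f h (as k) (xs k)" "j < H"
  shows "weight H f n as xs j \<le> weight H f n as xs (argmax_post H (posterior H f n as xs))"
proof -
  define W where "W = weight H f n as xs"
  define s where "s = (\<Sum>h<H. W h)"
  define m where "m = argmax_post H (posterior H f n as xs)"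
  have nn: "0 \<le> W h" if "h < H" for h using assms that by (auto simp: W_def intro!: weight_nonneg)
  have m: "m < H" using assms by (auto simp: m_def intro: argmax_post_less)
  have post: "posterior H f n as xs h = W h / s" if "h < H" for h
    using assms that by (simp add: W_def s_def posterior_eq_weight)
  have "posterior H f n as xs j \<le> posterior H f n as xs m"
    unfolding m_def using assms by (intro argmax_post_ge) auto
  then have le: "W j / s \<le> W m / s" using m assms post by simp
  have "0 \<le> s" unfolding s_def using nn by (auto intro!: sum_nonneg)
  show ?thesis
  proof (cases "s = 0")
    case True
    then have "\<forall>h\<in>{..<H}. W h = 0"
      using nn unfolding s_def by (subst sum_nonneg_eq_0_iff[symmetric]) auto
    with m assms show ?thesis by (auto simp: W_def m_def)
  next
    case False
    with le \<open>0 \<le> s\<close> show ?thesis by (simp add: W_def m_def divide_le_cancel)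
  qed
qed

lemma argmax_post_measurable [measurable]:
  assumes [measurable]: "\<And>i. i < H \<Longrightarrow> (\<lambda>x. \<rho> x i) \<in> borel_measurable N"
  shows "(\<lambda>x. argmax_post H (\<rho> x)) \<in> measurable N (count_space UNIV)"
proof -
  have [measurable]: "Measurable.pred N (\<lambda>x. h < H \<and> (\<forall>j<H. \<rho> x j \<le> \<rho> x h))" for h
  proof (cases "h < H")
    case True
    then have [measurable]: "(\<lambda>x. \<rho> x h) \<in> borel_measurable N" by simp
    have "Measurable.pred N (\<lambda>x. \<forall>j\<in>{..<H}. \<rho> x j \<le> \<rho> x h)" by (intro pred_intros_finite) auto
    with True show ?thesis by (simp add: Ball_def)
  qed simp
  show ?thesis unfolding argmax_post_def by measurable
qed

subsection \<open>Integrals over action and sample paths\<close>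

locale map_policy = sigma_finite_measure \<mu> for \<mu> :: "'x measure" +
  fixes H K :: nat and f :: "nat \<Rightarrow> nat \<Rightarrow> 'x \<Rightarrow> real" and lam :: "nat \<Rightarrow> nat \<Rightarrow> real"
  assumes H_pos: "0 < H"
    and dens_meas [measurable]: "h < H \<Longrightarrow> a < K \<Longrightarrow> f h a \<in> borel_measurable \<mu>"
    and dens_nonneg: "h < H \<Longrightarrow> a < K \<Longrightarrow> x \<in> space \<mu> \<Longrightarrow> 0 \<le> f h a x"
    and dens_one: "h < H \<Longrightarrow> a < K \<Longrightarrow> (\<integral>\<^sup>+ x. ennreal (f h a x) \<partial>\<mu>) = 1"
    and lam_nonneg: "h < H \<Longrightarrow> a < K \<Longrightarrow> 0 \<le> lam h a"
    and lam_sum: "h < H \<Longrightarrow> (\<Sum>a<K. lam h a) = 1"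
begin

sublocale product_sigma_finite "\<lambda>_::nat. \<mu>"
  by unfold_locales

abbreviation P :: "nat \<Rightarrow> (nat \<Rightarrow> 'x) measure" where
  "P n \<equiv> PiM {..<n} (\<lambda>_. \<mu>)"

abbreviation acts :: "nat \<Rightarrow> (nat \<Rightarrow> nat) set" where
  "acts n \<equiv> PiE {..<n} (\<lambda>_. {..<K})"

definition map_hyp :: "nat \<Rightarrow> (nat \<Rightarrow> nat) \<Rightarrow> (nat \<Rightarrow> 'x) \<Rightarrow> nat" where
  "map_hyp n as xs = argmax_post H (posterior H f n as xs)"

text \<open>Conditional probability of the actions given the samples. Its product with
  \<open>W n as xs h\<close> is the joint density of hypothesis, actions and samples.\<close>

definition policy_weight :: "nat \<Rightarrow> (nat \<Rightarrow> nat) \<Rightarrow> (nat \<Rightarrow> 'x) \<Rightarrow> real" where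
  "policy_weight n as xs = (\<Prod>k<n. lam (map_hyp k as xs) (as k))"

abbreviation W :: "nat \<Rightarrow> (nat \<Rightarrow> nat) \<Rightarrow> (nat \<Rightarrow> 'x) \<Rightarrow> nat \<Rightarrow> real" where
  "W \<equiv> weight H f"

text \<open>Integration against counting measure on action sequences times a power of
  \<open>\<mu>\<close>. With the finite sum outside, an integrand needs measurability in the samples
  for each fixed action sequence.\<close>

definition path_integral :: "nat \<Rightarrow> ((nat \<Rightarrow> nat) \<Rightarrow> (nat \<Rightarrow> 'x) \<Rightarrow> ennreal) \<Rightarrow> ennreal" where
  "path_integral n F = (\<Sum>as\<in>acts n. \<integral>\<^sup>+ xs. F as xs \<partial>P n)"

lemma map_hyp_less: "map_hyp n as xs < H"
  unfolding map_hyp_def using H_pos by (rule argmax_post_less)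

lemma map_hyp_cong:
  assumes "\<And>k. k < n \<Longrightarrow> as k = as' k" "\<And>k. k < n \<Longrightarrow> xs k = xs' k"
  shows "map_hyp n as xs = map_hyp n as' xs'"
  unfolding map_hyp_def using posterior_cong[OF assms] by simp

lemma policy_weight_Suc [simp]:
  "policy_weight (Suc n) as xs = policy_weight n as xs * lam (map_hyp n as xs) (as n)"
  by (simp add: policy_weight_def)

lemma policy_weight_0 [simp]: "policy_weight 0 as xs = 1"
  by (simp add: policy_weight_def)

lemma policy_weight_cong:
  assumes "\<And>k. k < n \<Longrightarrow> as k = as' k" "\<And>k. k < n \<Longrightarrow> xs k = xs' k"
  shows "policy_weight n as xs = policy_weight n as' xs'"
  unfolding policy_weight_def
proof (rule prod.cong)
  fix k assume "k \<in> {..<n}"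
  with assms have "map_hyp k as xs = map_hyp k as' xs'" by (intro map_hyp_cong) auto
  with assms \<open>k \<in> {..<n}\<close> show "lam (map_hyp k as xs) (as k) = lam (map_hyp k as' xs') (as' k)"
    by auto
qed simp

lemma policy_weight_nonneg: "(\<And>k. k < n \<Longrightarrow> as k < K) \<Longrightarrow> 0 \<le> policy_weight n as xs"
  by (auto simp: policy_weight_def intro!: prod_nonneg lam_nonneg map_hyp_less)

lemma posterior_measurable:
  assumes "\<And>k. k < n \<Longrightarrow> as k < K" "n \<le> m" "i < H"
  shows "(\<lambda>xs. posterior H f n as xs i) \<in> borel_measurable (P m)"
  using assms
proof (induction n arbitrary: i)
  case (Suc n)
  have [measurable]: "(\<lambda>xs. posterior H f n as xs h) \<in> borel_measurable (P m)" if "h < H" for h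
    using Suc that by simp
  have [measurable]: "(\<lambda>xs. f h (as n) (xs n)) \<in> borel_measurable (P m)" if "h < H" for h
  proof -
    have "(\<lambda>xs. xs n) \<in> measurable (P m) \<mu>" using Suc.prems by simp
    moreover have "f h (as n) \<in> borel_measurable \<mu>" using Suc.prems that by simp
    ultimately show ?thesis by (rule measurable_compose)
  qed
  show ?case using Suc.prems by simp
qed simp

lemma weight_measurable:
  assumes "\<And>k. k < n \<Longrightarrow> as k < K" "n \<le> m" "i < H"
  shows "(\<lambda>xs. W n as xs i) \<in> borel_measurable (P m)"
proof -
  have [measurable]: "(\<lambda>xs. f i (as k) (xs k)) \<in> borel_measurable (P m)" if "k < n" for k
  proof -
    have "(\<lambda>xs. xs k) \<in> measurable (P m) \<mu>" using assms that by simp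
    moreover have "f i (as k) \<in> borel_measurable \<mu>" using assms that by simp
    ultimately show ?thesis by (rule measurable_compose)
  qed
  show ?thesis unfolding weight_def by simp
qed

lemma map_hyp_measurable:
  assumes "\<And>k. k < n \<Longrightarrow> as k < K" "n \<le> m"
  shows "map_hyp n as \<in> measurable (P m) (count_space UNIV)"
  unfolding map_hyp_def
  by (rule argmax_post_measurable) (use assms in \<open>auto intro: posterior_measurable\<close>)

lemma policy_weight_measurable:
  assumes "\<And>k. k < n \<Longrightarrow> as k < K" "n \<le> m"
  shows "policy_weight n as \<in> borel_measurable (P m)"
proof -
  have [measurable]: "map_hyp k as \<in> measurable (P m) (count_space UNIV)" if "k < n" for k
    using assms that by (intro map_hyp_measurable) auto
  show ?thesis unfolding policy_weight_def by simp
qed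

lemma stop_cond_measurable:
  assumes "\<And>k. k < n \<Longrightarrow> as k < K" "n \<le> m"
  shows "Measurable.pred (P m) (\<lambda>xs. stop_cond H f \<delta> as xs n)"
proof -
  have [measurable]: "(\<lambda>xs. posterior H f n as xs h) \<in> borel_measurable (P m)" if "h < H" for h
    using assms that by (intro posterior_measurable)
  have "Measurable.pred (P m) (\<lambda>xs. \<exists>i\<in>{..<H}. 1 - \<delta> < posterior H f n as xs i)"
    by (intro pred_intros_finite) auto
  then show ?thesis unfolding stop_cond_def by (simp add: Bex_def)
qed

lemma path_dens_nonneg:
  assumes "as \<in> acts n" "xs \<in> space (P n)" "h < H" "k < n"
  shows "0 \<le> f h (as k) (xs k)"
  using assms by (intro dens_nonneg) (auto simp: space_PiM)

lemma path_weight_nonneg: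
  assumes "as \<in> acts n" "xs \<in> space (P n)" "h < H"
  shows "0 \<le> W n as xs h"
  using path_dens_nonneg[OF assms] by (intro weight_nonneg)

section \<open>Calculus of path integrals and their one-step recursion\<close>

lemma path_integral_mono:
  assumes "\<And>as xs. as \<in> acts n \<Longrightarrow> xs \<in> space (P n) \<Longrightarrow> F as xs \<le> G as xs"
  shows "path_integral n F \<le> path_integral n G"
  unfolding path_integral_def using assms by (intro sum_mono nn_integral_mono)

lemma path_integral_cong:
  assumes "\<And>as xs. as \<in> acts n \<Longrightarrow> xs \<in> space (P n) \<Longrightarrow> F as xs = G as xs"
  shows "path_integral n F = path_integral n G"
  unfolding path_integral_def using assms by (intro sum.cong nn_integral_cong refl)

lemma path_integral_cmult:
  assumes "\<And>as. as \<in> acts n \<Longrightarrow> F as \<in> borel_measurable (P n)"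
  shows "path_integral n (\<lambda>as xs. c * F as xs) = c * path_integral n F"
  unfolding path_integral_def using assms by (simp add: nn_integral_cmult sum_distrib_left)

lemma path_integral_sum:
  assumes "finite I" "\<And>i as. i \<in> I \<Longrightarrow> as \<in> acts n \<Longrightarrow> F i as \<in> borel_measurable (P n)"
  shows "path_integral n (\<lambda>as xs. \<Sum>i\<in>I. F i as xs) = (\<Sum>i\<in>I. path_integral n (F i))"
  unfolding path_integral_def using assms
  by (subst sum.swap) (auto intro!: sum.cong nn_integral_sum)

lemma path_integral_0: "path_integral 0 F = F (\<lambda>_. undefined) (\<lambda>_. undefined)"
  by (simp add: path_integral_def PiM_empty nn_integral_count_space_finite)

text \<open>Fubini for the index \<open>n\<close>, with the last action and sample innermost, so
  that one step can be estimated for a fixed past.\<close>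

lemma path_integral_Suc:
  assumes F: "\<And>as. as \<in> acts (Suc n) \<Longrightarrow> F as \<in> borel_measurable (P (Suc n))"
  shows "path_integral (Suc n) F =
    path_integral n (\<lambda>as xs. \<Sum>a<K. \<integral>\<^sup>+ x. F (as(n := a)) (xs(n := x)) \<partial>\<mu>)"
proof -
  have upd: "as(n := a) \<in> acts (Suc n)" if "as \<in> acts n" "a < K" for as a
    using that by (auto simp: lessThan_Suc PiE_def extensional_def Pi_def)
  have meas: "(\<lambda>xs. \<integral>\<^sup>+ x. F (as(n := a)) (xs(n := x)) \<partial>\<mu>) \<in> borel_measurable (P n)"
    if "as \<in> acts n" "a < K" for as a
  proof -
    have [measurable]: "F (as(n := a)) \<in> borel_measurable (PiM (insert n {..<n}) (\<lambda>_. \<mu>))"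
      using F[OF upd[OF that]] by (simp add: lessThan_Suc)
    show ?thesis by measurable
  qed
  have "path_integral (Suc n) F = (\<Sum>as\<in>PiE (insert n {..<n}) (\<lambda>_. {..<K}). \<integral>\<^sup>+ xs. F as xs \<partial>P (Suc n))"
    by (simp add: path_integral_def lessThan_Suc)
  also have "\<dots> = (\<Sum>(a, as)\<in>{..<K} \<times> acts n. \<integral>\<^sup>+ xs. F (as(n := a)) xs \<partial>P (Suc n))"
    unfolding PiE_insert_eq by (subst sum.reindex[OF inj_combinator]) (auto simp: case_prod_beta)
  also have "\<dots> = (\<Sum>a<K. \<Sum>as\<in>acts n. \<integral>\<^sup>+ xs. F (as(n := a)) xs \<partial>P (Suc n))"
    by (simp add: sum.cartesian_product)
  also have "\<dots> = (\<Sum>a<K. \<Sum>as\<in>acts n. \<integral>\<^sup>+ xs. \<integral>\<^sup>+ x. F (as(n := a)) (xs(n := x)) \<partial>\<mu> \<partial>P n)"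
  proof (intro sum.cong refl)
    fix a as assume "a \<in> {..<K}" "as \<in> acts n"
    then have "F (as(n := a)) \<in> borel_measurable (PiM (insert n {..<n}) (\<lambda>_. \<mu>))"
      using F[OF upd[of as a]] by (simp add: lessThan_Suc)
    then show "(\<integral>\<^sup>+ xs. F (as(n := a)) xs \<partial>P (Suc n)) =
        (\<integral>\<^sup>+ xs. \<integral>\<^sup>+ x. F (as(n := a)) (xs(n := x)) \<partial>\<mu> \<partial>P n)"
      unfolding lessThan_Suc by (intro product_nn_integral_insert) simp_all
  qed
  also have "\<dots> = path_integral n (\<lambda>as xs. \<Sum>a<K. \<integral>\<^sup>+ x. F (as(n := a)) (xs(n := x)) \<partial>\<mu>)"
    unfolding path_integral_def
    by (subst sum.swap) (intro sum.cong refl nn_integral_sum[symmetric] meas, simp_all)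
  finally show ?thesis .
qed

lemma acts_less: "as \<in> acts n \<Longrightarrow> k < n \<Longrightarrow> as k < K"
  by auto

text \<open>Conditioning on the past: \<open>map_hyp n\<close> depends on the first \<open>n\<close>
  steps only, so the new action probability is constant in the new sample and leaves the inner
  integral.\<close>

lemma path_integral_step:
  assumes g: "\<And>as. as \<in> acts (Suc n) \<Longrightarrow> g as \<in> borel_measurable (P (Suc n))"
  shows "path_integral (Suc n) (\<lambda>as xs. ennreal (policy_weight (Suc n) as xs) * g as xs) =
    path_integral n (\<lambda>as xs. ennreal (policy_weight n as xs) *
      (\<Sum>a<K. ennreal (lam (map_hyp n as xs) a) * (\<integral>\<^sup>+ x. g (as(n := a)) (xs(n := x)) \<partial>\<mu>)))"
proof -
  have "path_integral (Suc n) (\<lambda>as xs. ennreal (policy_weight (Suc n) as xs) * g as xs) =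
     path_integral n (\<lambda>as xs. \<Sum>a<K. \<integral>\<^sup>+ x. ennreal (policy_weight (Suc n) (as(n := a)) (xs(n := x))) *
        g (as(n := a)) (xs(n := x)) \<partial>\<mu>)"
  proof (rule path_integral_Suc)
    fix as assume as: "as \<in> acts (Suc n)"
    have [measurable]: "policy_weight (Suc n) as \<in> borel_measurable (P (Suc n))"
      by (rule policy_weight_measurable) (use acts_less[OF as] in auto)
    note g[OF as, measurable]
    show "(\<lambda>xs. ennreal (policy_weight (Suc n) as xs) * g as xs) \<in> borel_measurable (P (Suc n))"
      by measurable
  qed
  also have "\<dots> = path_integral n (\<lambda>as xs. ennreal (policy_weight n as xs) *
      (\<Sum>a<K. ennreal (lam (map_hyp n as xs) a) * (\<integral>\<^sup>+ x. g (as(n := a)) (xs(n := x)) \<partial>\<mu>)))"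
  proof (rule path_integral_cong)
    fix as xs assume as: "as \<in> acts n" and xs: "xs \<in> space (P n)"
    have eq: "policy_weight (Suc n) (as(n := a)) (xs(n := x)) =
        policy_weight n as xs * lam (map_hyp n as xs) a" for a x
    proof -
      have "policy_weight n (as(n := a)) (xs(n := x)) = policy_weight n as xs"
        by (intro policy_weight_cong) auto
      moreover have "map_hyp n (as(n := a)) (xs(n := x)) = map_hyp n as xs"
        by (intro map_hyp_cong) auto
      ultimately show ?thesis by simp
    qed
    have nn: "0 \<le> policy_weight n as xs" using as by (intro policy_weight_nonneg) auto
    have meas: "(\<lambda>x. g (as(n := a)) (xs(n := x))) \<in> borel_measurable \<mu>" if "a < K" for a
    proof -
      have "as(n := a) \<in> acts (Suc n)"
        using as that by (auto simp: lessThan_Suc PiE_def extensional_def Pi_def)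
      from g[OF this] have "g (as(n := a)) \<in> borel_measurable (PiM (insert n {..<n}) (\<lambda>_. \<mu>))"
        by (simp add: lessThan_Suc)
      moreover have "(\<lambda>x. xs(n := x)) \<in> measurable \<mu> (PiM (insert n {..<n}) (\<lambda>_. \<mu>))"
        using xs by measurable
      ultimately show ?thesis by (rule measurable_compose[rotated])
    qed
    have "(\<integral>\<^sup>+ x. ennreal (policy_weight (Suc n) (as(n := a)) (xs(n := x))) *
        g (as(n := a)) (xs(n := x)) \<partial>\<mu>) = ennreal (policy_weight n as xs) *
        (ennreal (lam (map_hyp n as xs) a) * (\<integral>\<^sup>+ x. g (as(n := a)) (xs(n := x)) \<partial>\<mu>))" if "a < K" for a
      unfolding eq using nn lam_nonneg[OF map_hyp_less that, of n as xs] meas[OF that]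
      by (simp add: ennreal_mult nn_integral_cmult mult.assoc)
    then show "(\<Sum>a<K. \<integral>\<^sup>+ x. ennreal (policy_weight (Suc n) (as(n := a)) (xs(n := x))) *
        g (as(n := a)) (xs(n := x)) \<partial>\<mu>) = ennreal (policy_weight n as xs) *
      (\<Sum>a<K. ennreal (lam (map_hyp n as xs) a) * (\<integral>\<^sup>+ x. g (as(n := a)) (xs(n := x)) \<partial>\<mu>))"
      by (simp add: sum_distrib_left)
  qed
  finally show ?thesis .
qed

lemma weight_upd: "W (Suc n) (as(n := a)) (xs(n := x)) h = W n as xs h * f h a x"
proof -
  have "W n (as(n := a)) (xs(n := x)) = W n as xs" by (intro weight_cong) auto
  then show ?thesis by simp
qed

lemma weight_measurable_acts:
  "as \<in> acts n \<Longrightarrow> h < H \<Longrightarrow> (\<lambda>xs. W n as xs h) \<in> borel_measurable (P n)"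
  by (intro weight_measurable) (simp_all add: acts_less)

lemma last_sample_measurable:
  assumes "G \<in> measurable \<mu> N"
  shows "(\<lambda>xs. G (xs n)) \<in> measurable (P (Suc n)) N"
proof -
  have "(\<lambda>xs. xs n) \<in> measurable (P (Suc n)) \<mu>" by simp
  then show ?thesis using assms by (rule measurable_compose)
qed

text \<open>Under hypothesis \<open>h\<close> the last sample has density \<open>f h a\<close> given
  the past and action \<open>a\<close>. The case \<open>G = 1\<close> yields the total mass, other
  choices yield moments of one observation.\<close>

lemma path_integral_weight_Suc:
  assumes h: "h < H" and G: "\<And>a. a < K \<Longrightarrow> G a \<in> borel_measurable \<mu>"
  shows "path_integral (Suc n) (\<lambda>as xs. ennreal (policy_weight (Suc n) as xs) *
      (ennreal (W (Suc n) as xs h) * G (as n) (xs n))) =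
    path_integral n (\<lambda>as xs. ennreal (policy_weight n as xs) * (ennreal (W n as xs h) *
      (\<Sum>a<K. ennreal (lam (map_hyp n as xs) a) * (\<integral>\<^sup>+ x. ennreal (f h a x) * G a x \<partial>\<mu>))))"
proof (subst path_integral_step)
  fix as assume as: "as \<in> acts (Suc n)"
  note [measurable] = weight_measurable_acts[OF as h] last_sample_measurable[OF G[OF acts_less[OF as lessI]], of n]
  show "(\<lambda>xs. ennreal (W (Suc n) as xs h) * G (as n) (xs n)) \<in> borel_measurable (P (Suc n))"
    by measurable
next
  show "path_integral n (\<lambda>as xs. ennreal (policy_weight n as xs) *
      (\<Sum>a<K. ennreal (lam (map_hyp n as xs) a) *
        (\<integral>\<^sup>+ x. ennreal (W (Suc n) (as(n := a)) (xs(n := x)) h) *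
           G ((as(n := a)) n) ((xs(n := x)) n) \<partial>\<mu>))) =
    path_integral n (\<lambda>as xs. ennreal (policy_weight n as xs) * (ennreal (W n as xs h) *
      (\<Sum>a<K. ennreal (lam (map_hyp n as xs) a) * (\<integral>\<^sup>+ x. ennreal (f h a x) * G a x \<partial>\<mu>))))"
  proof (rule path_integral_cong)
    fix as xs assume as: "as \<in> acts n" and xs: "xs \<in> space (P n)"
    have nn: "0 \<le> W n as xs h" using as xs h by (rule path_weight_nonneg)
    have "(\<integral>\<^sup>+ x. ennreal (W (Suc n) (as(n := a)) (xs(n := x)) h) *
           G ((as(n := a)) n) ((xs(n := x)) n) \<partial>\<mu>) =
        ennreal (W n as xs h) * (\<integral>\<^sup>+ x. ennreal (f h a x) * G a x \<partial>\<mu>)" if "a < K" for a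
    proof -
      note [measurable] = G[OF that] dens_meas[OF h that]
      have "(\<integral>\<^sup>+ x. ennreal (W (Suc n) (as(n := a)) (xs(n := x)) h) *
           G ((as(n := a)) n) ((xs(n := x)) n) \<partial>\<mu>) =
        (\<integral>\<^sup>+ x. ennreal (W n as xs h) * (ennreal (f h a x) * G a x) \<partial>\<mu>)"
        unfolding weight_upd using nn by (intro nn_integral_cong) (simp add: ennreal_mult' mult.assoc)
      then show ?thesis by (simp add: nn_integral_cmult)
    qed
    then show "ennreal (policy_weight n as xs) *
      (\<Sum>a<K. ennreal (lam (map_hyp n as xs) a) *
        (\<integral>\<^sup>+ x. ennreal (W (Suc n) (as(n := a)) (xs(n := x)) h) *
           G ((as(n := a)) n) ((xs(n := x)) n) \<partial>\<mu>)) =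
      ennreal (policy_weight n as xs) * (ennreal (W n as xs h) *
      (\<Sum>a<K. ennreal (lam (map_hyp n as xs) a) * (\<integral>\<^sup>+ x. ennreal (f h a x) * G a x \<partial>\<mu>)))"
      by (simp add: sum_distrib_left mult.left_commute)
  qed
qed

text \<open>Each step integrates to 1, so the prior mass of \<open>h\<close> is preserved. This also
  shows that in-range paths exhaust the probability.\<close>

lemma path_mass:
  assumes h: "h < H"
  shows "path_integral n (\<lambda>as xs. ennreal (policy_weight n as xs) * ennreal (W n as xs h)) =
    ennreal (1 / real H)"
proof (induction n)
  case 0
  show ?case by (simp add: path_integral_0)
next
  case (Suc n)
  have lam: "(\<Sum>a<K. ennreal (lam (map_hyp n as xs) a) * (\<integral>\<^sup>+ x. ennreal (f h a x) * 1 \<partial>\<mu>)) = 1" for as xs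
  proof -
    have "(\<Sum>a<K. ennreal (lam (map_hyp n as xs) a) * (\<integral>\<^sup>+ x. ennreal (f h a x) * 1 \<partial>\<mu>)) =
        (\<Sum>a<K. ennreal (lam (map_hyp n as xs) a))"
      using dens_one[OF h] by (intro sum.cong) auto
    also have "\<dots> = ennreal (\<Sum>a<K. lam (map_hyp n as xs) a)"
      using lam_nonneg[OF map_hyp_less] by (intro sum_ennreal) auto
    finally show ?thesis using lam_sum[OF map_hyp_less] by simp
  qed
  show ?case using path_integral_weight_Suc[OF h, of "\<lambda>_ _. 1" n] Suc unfolding lam by simp
qed

text \<open>The action probability and the prior are estimated by 1. The loss is harmless: what
  counts is a bound free of \<open>n\<close>.\<close>

lemma path_integral_last_le:
  assumes h: "h < H" and a: "a < K" and G [measurable]: "G \<in> borel_measurable \<mu>"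
  shows "path_integral (Suc n) (\<lambda>as xs. ennreal (policy_weight (Suc n) as xs) *
      (ennreal (W (Suc n) as xs h) * (if as n = a then G (xs n) else 0))) \<le>
    (\<integral>\<^sup>+ x. ennreal (f h a x) * G x \<partial>\<mu>)"
proof -
  let ?I = "\<integral>\<^sup>+ x. ennreal (f h a x) * G x \<partial>\<mu>"
  have lam1: "lam i a \<le> 1" if "i < H" for i
    unfolding lam_sum[OF that, symmetric] using lam_nonneg[OF that] a
    by (intro member_le_sum) auto
  have "path_integral (Suc n) (\<lambda>as xs. ennreal (policy_weight (Suc n) as xs) *
      (ennreal (W (Suc n) as xs h) * (if as n = a then G (xs n) else 0))) =
    path_integral n (\<lambda>as xs. ennreal (policy_weight n as xs) * (ennreal (W n as xs h) *
      (\<Sum>b<K. ennreal (lam (map_hyp n as xs) b) *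
        (\<integral>\<^sup>+ x. ennreal (f h b x) * (if b = a then G x else 0) \<partial>\<mu>))))"
    using path_integral_weight_Suc[OF h, of "\<lambda>b x. if b = a then G x else 0" n] by simp
  also have "\<dots> \<le> path_integral n (\<lambda>as xs. ?I * (ennreal (policy_weight n as xs) * ennreal (W n as xs h)))"
  proof (rule path_integral_mono)
    fix as xs
    have "(\<Sum>b<K. ennreal (lam (map_hyp n as xs) b) *
        (\<integral>\<^sup>+ x. ennreal (f h b x) * (if b = a then G x else 0) \<partial>\<mu>)) =
      (\<Sum>b<K. if b = a then ennreal (lam (map_hyp n as xs) a) * ?I else 0)"
      by (intro sum.cong) auto
    also have "\<dots> = ennreal (lam (map_hyp n as xs) a) * ?I" using a by simp
    also have "\<dots> \<le> 1 * ?I" using lam1[OF map_hyp_less] by (intro mult_right_mono) auto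
    finally have "(\<Sum>b<K. ennreal (lam (map_hyp n as xs) b) *
        (\<integral>\<^sup>+ x. ennreal (f h b x) * (if b = a then G x else 0) \<partial>\<mu>)) \<le> ?I" by simp
    from mult_left_mono[OF this, of "ennreal (policy_weight n as xs) * ennreal (W n as xs h)"]
    show "ennreal (policy_weight n as xs) * (ennreal (W n as xs h) *
      (\<Sum>b<K. ennreal (lam (map_hyp n as xs) b) *
        (\<integral>\<^sup>+ x. ennreal (f h b x) * (if b = a then G x else 0) \<partial>\<mu>))) \<le>
      ?I * (ennreal (policy_weight n as xs) * ennreal (W n as xs h))"
      by (simp add: ac_simps)
  qed
  also have "\<dots> = ?I * ennreal (1 / real H)"
  proof (subst path_integral_cmult)
    fix as assume as: "as \<in> acts n"
    note [measurable] = weight_measurable_acts[OF as h]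
      policy_weight_measurable[of n as n, OF acts_less[OF as] order.refl]
    show "(\<lambda>xs. ennreal (policy_weight n as xs) * ennreal (W n as xs h)) \<in> borel_measurable (P n)"
      by measurable
  qed (simp add: path_mass[OF h])
  also have "\<dots> \<le> ?I * 1"
    using H_pos by (intro mult_left_mono) (auto simp: divide_le_eq_1)
  finally show ?thesis by simp
qed

section \<open>Pairwise affinities, the stopping rule and geometric decay\<close>

definition pair_affinity :: "nat \<Rightarrow> (nat \<Rightarrow> nat) \<Rightarrow> (nat \<Rightarrow> 'x) \<Rightarrow> real" where
  "pair_affinity n as xs = (\<Sum>i<H. \<Sum>j\<in>{..<H} - {i}. sqrt (W n as xs i * W n as xs j))"

lemma pair_affinity_measurable:
  "as \<in> acts n \<Longrightarrow> pair_affinity n as \<in> borel_measurable (P n)"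
  unfolding pair_affinity_def
  by (intro borel_measurable_sum borel_measurable_sqrt borel_measurable_times
        measurable_compose[OF _ borel_measurable_sqrt] weight_measurable_acts) auto

lemma pair_affinity_nonneg:
  assumes "as \<in> acts n" "xs \<in> space (P n)"
  shows "0 \<le> pair_affinity n as xs"
  unfolding pair_affinity_def using path_weight_nonneg[OF assms]
  by (intro sum_nonneg) auto

text \<open>The factor that the integral of \<open>sqrt (w i * w j)\<close> gains in one step when
  the current maximiser is \<open>h\<close>.\<close>

definition mixed_affinity :: "nat \<Rightarrow> nat \<Rightarrow> nat \<Rightarrow> real" where
  "mixed_affinity h i j = (\<Sum>a<K. lam h a * affinity \<mu> (f i a) (f j a))"

lemma
  assumes "i < H" "j < H" "a < K"
  shows dens_affinity_integrable: "integrable \<mu> (\<lambda>x. sqrt (f i a x * f j a x))"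
    and dens_affinity_nonneg: "0 \<le> affinity \<mu> (f i a) (f j a)"
    and dens_affinity_le_1: "affinity \<mu> (f i a) (f j a) \<le> 1"
    and dens_affinity_less_1: "KLD \<mu> (f i a) (f j a) \<noteq> 0 \<Longrightarrow> affinity \<mu> (f i a) (f j a) < 1"
proof -
  have i: "f i a \<in> borel_measurable \<mu>" "\<forall>x\<in>space \<mu>. 0 \<le> f i a x" "(\<integral>\<^sup>+ x. ennreal (f i a x) \<partial>\<mu>) = 1"
    and j: "f j a \<in> borel_measurable \<mu>" "\<forall>x\<in>space \<mu>. 0 \<le> f j a x" "(\<integral>\<^sup>+ x. ennreal (f j a x) \<partial>\<mu>) = 1"
    using assms by (auto intro: dens_nonneg dens_one)
  from affinity_integrable[OF i j] affinity_nonneg[OF i j] affinity_le_1[OF i j] affinity_less_1[OF i j]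
  show "integrable \<mu> (\<lambda>x. sqrt (f i a x * f j a x))" "0 \<le> affinity \<mu> (f i a) (f j a)"
    "affinity \<mu> (f i a) (f j a) \<le> 1"
    "KLD \<mu> (f i a) (f j a) \<noteq> 0 \<Longrightarrow> affinity \<mu> (f i a) (f j a) < 1" by auto
qed

lemma mixed_affinity_le_1:
  assumes "h < H" "i < H" "j < H"
  shows "mixed_affinity h i j \<le> 1"
proof -
  have "mixed_affinity h i j \<le> (\<Sum>a<K. lam h a * 1)"
    unfolding mixed_affinity_def using assms
    by (intro sum_mono mult_left_mono dens_affinity_le_1 lam_nonneg) auto
  with lam_sum[OF assms(1)] show ?thesis by simp
qed

text \<open>One action of positive probability with affinity below 1 is enough, since every other
  summand is at most \<open>lam h a\<close>.\<close>

lemma mixed_affinity_less_1: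
  assumes "h < H" "i < H" "j < H" "\<exists>a<K. 0 < lam h a \<and> KLD \<mu> (f i a) (f j a) \<noteq> 0"
  shows "mixed_affinity h i j < 1"
proof -
  obtain a where a: "a < K" "0 < lam h a" "KLD \<mu> (f i a) (f j a) \<noteq> 0" using assms by auto
  have "mixed_affinity h i j < (\<Sum>a<K. lam h a * 1)"
    unfolding mixed_affinity_def
  proof (rule sum_strict_mono_ex1)
    show "\<forall>a\<in>{..<K}. lam h a * affinity \<mu> (f i a) (f j a) \<le> lam h a * 1"
      using assms by (auto intro!: mult_left_le dens_affinity_le_1 lam_nonneg)
    have "lam h a * affinity \<mu> (f i a) (f j a) < lam h a * 1"
      using a assms by (intro mult_strict_left_mono dens_affinity_less_1) auto
    with a(1) show "\<exists>a\<in>{..<K}. lam h a * affinity \<mu> (f i a) (f j a) < lam h a * 1" by blast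
  qed simp
  with lam_sum[OF assms(1)] show ?thesis by simp
qed

text \<open>For a fixed past, weights and maximiser are constants. The new sample contributes
  \<open>sqrt (f i a x * f j a x)\<close>, whose integral is an affinity, and averaging over the
  action gives \<open>mixed_affinity\<close>. The right side keeps the path-dependent maximiser, so
  contraction can be applied path by path.\<close>

lemma path_integral_pair_affinity_Suc:
  "path_integral (Suc n) (\<lambda>as xs. ennreal (policy_weight (Suc n) as xs) * ennreal (pair_affinity (Suc n) as xs)) =
   path_integral n (\<lambda>as xs. ennreal (policy_weight n as xs) *
     ennreal (\<Sum>i<H. \<Sum>j\<in>{..<H} - {i}. sqrt (W n as xs i * W n as xs j) * mixed_affinity (map_hyp n as xs) i j))"
proof (subst path_integral_step)
  fix as assume "as \<in> acts (Suc n)"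
  then show "(\<lambda>xs. ennreal (pair_affinity (Suc n) as xs)) \<in> borel_measurable (P (Suc n))"
    using pair_affinity_measurable by simp
next
  show "path_integral n (\<lambda>as xs. ennreal (policy_weight n as xs) *
      (\<Sum>a<K. ennreal (lam (map_hyp n as xs) a) *
        (\<integral>\<^sup>+ x. ennreal (pair_affinity (Suc n) (as(n := a)) (xs(n := x))) \<partial>\<mu>))) =
    path_integral n (\<lambda>as xs. ennreal (policy_weight n as xs) *
     ennreal (\<Sum>i<H. \<Sum>j\<in>{..<H} - {i}. sqrt (W n as xs i * W n as xs j) * mixed_affinity (map_hyp n as xs) i j))"
  proof (rule path_integral_cong)
    fix as xs assume as: "as \<in> acts n" and xs: "xs \<in> space (P n)"
    define w where "w = W n as xs"
    define h where "h = map_hyp n as xs"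
    have h: "h < H" unfolding h_def by (rule map_hyp_less)
    have w: "0 \<le> w i" if "i < H" for i unfolding w_def using as xs that by (rule path_weight_nonneg)
    have inner: "(\<integral>\<^sup>+ x. ennreal (pair_affinity (Suc n) (as(n := a)) (xs(n := x))) \<partial>\<mu>) =
        ennreal (\<Sum>i<H. \<Sum>j\<in>{..<H} - {i}. sqrt (w i * w j) * affinity \<mu> (f i a) (f j a))" if "a < K" for a
    proof -
      have int: "integrable \<mu> (\<lambda>x. \<Sum>i<H. \<Sum>j\<in>{..<H} - {i}. sqrt (w i * w j) * sqrt (f i a x * f j a x))"
        using that by (intro Bochner_Integration.integrable_sum integrable_mult_right dens_affinity_integrable) auto
      have "pair_affinity (Suc n) (as(n := a)) (xs(n := x)) =
         (\<Sum>i<H. \<Sum>j\<in>{..<H} - {i}. sqrt (w i * w j) * sqrt (f i a x * f j a x))" for x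
        unfolding pair_affinity_def weight_upd by (simp add: w_def real_sqrt_mult ac_simps)
      then have "(\<integral>\<^sup>+ x. ennreal (pair_affinity (Suc n) (as(n := a)) (xs(n := x))) \<partial>\<mu>) =
        (\<integral>\<^sup>+ x. ennreal (\<Sum>i<H. \<Sum>j\<in>{..<H} - {i}. sqrt (w i * w j) * sqrt (f i a x * f j a x)) \<partial>\<mu>)"
        by simp
      also have "\<dots> = ennreal (\<integral>x. (\<Sum>i<H. \<Sum>j\<in>{..<H} - {i}. sqrt (w i * w j) * sqrt (f i a x * f j a x)) \<partial>\<mu>)"
        using w that dens_nonneg by (intro nn_integral_eq_integral int AE_I2 sum_nonneg) auto
      also have "(\<integral>x. (\<Sum>i<H. \<Sum>j\<in>{..<H} - {i}. sqrt (w i * w j) * sqrt (f i a x * f j a x)) \<partial>\<mu>) =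
          (\<Sum>i<H. \<Sum>j\<in>{..<H} - {i}. sqrt (w i * w j) * affinity \<mu> (f i a) (f j a))"
        unfolding affinity_def using that dens_affinity_integrable
        by (subst Bochner_Integration.integral_sum, force intro!: Bochner_Integration.integrable_sum)
           (intro sum.cong refl, subst Bochner_Integration.integral_sum, auto)
      finally show ?thesis .
    qed
    have "(\<Sum>a<K. ennreal (lam h a) * (\<integral>\<^sup>+ x. ennreal (pair_affinity (Suc n) (as(n := a)) (xs(n := x))) \<partial>\<mu>)) =
      (\<Sum>a<K. ennreal (lam h a * (\<Sum>i<H. \<Sum>j\<in>{..<H} - {i}. sqrt (w i * w j) * affinity \<mu> (f i a) (f j a))))"
      using lam_nonneg[OF h] by (intro sum.cong refl) (simp add: inner ennreal_mult')
    also have "\<dots> = ennreal (\<Sum>a<K. lam h a * (\<Sum>i<H. \<Sum>j\<in>{..<H} - {i}. sqrt (w i * w j) * affinity \<mu> (f i a) (f j a)))"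
      using lam_nonneg[OF h] w dens_affinity_nonneg
      by (intro sum_ennreal mult_nonneg_nonneg sum_nonneg) auto
    also have "(\<Sum>a<K. lam h a * (\<Sum>i<H. \<Sum>j\<in>{..<H} - {i}. sqrt (w i * w j) * affinity \<mu> (f i a) (f j a))) =
      (\<Sum>a<K. \<Sum>i<H. \<Sum>j\<in>{..<H} - {i}. sqrt (w i * w j) * (lam h a * affinity \<mu> (f i a) (f j a)))"
      by (simp add: sum_distrib_left mult.left_commute)
    also have "\<dots> = (\<Sum>i<H. \<Sum>a<K. \<Sum>j\<in>{..<H} - {i}. sqrt (w i * w j) * (lam h a * affinity \<mu> (f i a) (f j a)))"
      by (rule sum.swap)
    also have "\<dots> = (\<Sum>i<H. \<Sum>j\<in>{..<H} - {i}. \<Sum>a<K. sqrt (w i * w j) * (lam h a * affinity \<mu> (f i a) (f j a)))"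
      by (intro sum.cong refl sum.swap)
    also have "\<dots> = (\<Sum>i<H. \<Sum>j\<in>{..<H} - {i}. sqrt (w i * w j) * mixed_affinity h i j)"
      by (simp add: mixed_affinity_def sum_distrib_left)
    finally show "ennreal (policy_weight n as xs) *
      (\<Sum>a<K. ennreal (lam (map_hyp n as xs) a) *
        (\<integral>\<^sup>+ x. ennreal (pair_affinity (Suc n) (as(n := a)) (xs(n := x))) \<partial>\<mu>)) =
      ennreal (policy_weight n as xs) *
     ennreal (\<Sum>i<H. \<Sum>j\<in>{..<H} - {i}. sqrt (W n as xs i * W n as xs j) * mixed_affinity (map_hyp n as xs) i j)"
      by (simp add: w_def h_def del: fun_upd_apply)
  qed
qed

lemma path_posterior:
  assumes as: "as \<in> acts n" and xs: "xs \<in> space (P n)" and h: "h < H"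
  shows "posterior H f n as xs h = W n as xs h / (\<Sum>i<H. W n as xs i)"
  using h by (intro posterior_eq_weight path_dens_nonneg[OF as xs])

text \<open>The pairs \<open>(m, j)\<close> with the maximiser \<open>m\<close> alone contribute at least the error mass,
  since \<open>sqrt (w m * w j) \<ge> w j\<close>.\<close>

lemma weight_le_pair_affinity:
  assumes as: "as \<in> acts n" and xs: "xs \<in> space (P n)" and \<delta>: "0 < \<delta>"
    and not: "\<not> stop_cond H f \<delta> as xs n"
  shows "(\<Sum>h<H. W n as xs h) \<le> 1 / \<delta> * pair_affinity n as xs"
proof -
  define w where "w = W n as xs"
  define s where "s = (\<Sum>h<H. w h)"
  define m where "m = map_hyp n as xs"
  have m: "m < H" unfolding m_def by (rule map_hyp_less)
  have nn: "0 \<le> w h" if "h < H" for h unfolding w_def using as xs that by (rule path_weight_nonneg)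
  have wm: "w j \<le> w m" if "j < H" for j
    unfolding w_def m_def map_hyp_def using path_dens_nonneg[OF as xs] that
    by (intro weight_le_argmax) auto
  have "posterior H f n as xs m \<le> 1 - \<delta>" using not m unfolding stop_cond_def by force
  then have post: "w m / s \<le> 1 - \<delta>"
    using path_posterior[OF as xs m] by (simp add: w_def s_def)
  have s0: "0 \<le> s" unfolding s_def using nn by (intro sum_nonneg) auto
  \<comment> \<open>Not having stopped leaves at least the fraction \<open>\<delta>\<close> of the
    mass off the maximiser. If \<open>s = 0\<close> the quotient says nothing, but then all weights
    are 0.\<close>
  have "\<delta> * s \<le> s - w m"
  proof (cases "s = 0")
    case True
    then have "w m = 0" using nn m unfolding s_def by (subst (asm) sum_nonneg_eq_0_iff) auto
    with True show ?thesis by simp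
  next
    case False
    with s0 have "0 < s" by simp
    with post have "w m \<le> (1 - \<delta>) * s" by (simp only: divide_le_eq if_True)
    then show ?thesis by (simp add: algebra_simps)
  qed
  also have "s - w m = (\<Sum>j\<in>{..<H} - {m}. w j)" unfolding s_def using m by (simp add: sum_diff1)
  also have "\<dots> \<le> (\<Sum>j\<in>{..<H} - {m}. sqrt (w m * w j))"
  proof (rule sum_mono)
    fix j assume "j \<in> {..<H} - {m}"
    then have "sqrt (w j * w j) \<le> sqrt (w m * w j)" using nn wm
      by (intro real_sqrt_le_mono mult_right_mono) auto
    then show "w j \<le> sqrt (w m * w j)" using nn \<open>j \<in> _\<close> by simp
  qed
  also have "\<dots> \<le> (\<Sum>i<H. \<Sum>j\<in>{..<H} - {i}. sqrt (w i * w j))"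
    using m nn by (intro member_le_sum[where f = "\<lambda>i. \<Sum>j\<in>{..<H} - {i}. sqrt (w i * w j)"] sum_nonneg) auto
  finally show ?thesis
    using \<delta> by (simp add: w_def s_def pair_affinity_def field_simps)
qed

text \<open>The left side is the weight of the hypotheses for which declaring the maximiser is
  wrong. The maximiser has at least the posterior of the component that triggered stopping.\<close>

lemma stopped_error_weight:
  assumes as: "as \<in> acts n" and xs: "xs \<in> space (P n)" and \<delta>: "0 < \<delta>" "\<delta> < 1"
    and stop: "stop_cond H f \<delta> as xs n"
  shows "(\<Sum>h\<in>{..<H} - {map_hyp n as xs}. W n as xs h) \<le> \<delta> * (\<Sum>h<H. W n as xs h)"
proof -
  define w where "w = W n as xs"
  define s where "s = (\<Sum>h<H. w h)"
  define m where "m = map_hyp n as xs"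
  have m: "m < H" unfolding m_def by (rule map_hyp_less)
  have nn: "0 \<le> w h" if "h < H" for h unfolding w_def using as xs that by (rule path_weight_nonneg)
  have post: "posterior H f n as xs h = w h / s" if "h < H" for h
    using path_posterior[OF as xs that] by (simp add: w_def s_def)
  obtain i where i: "i < H" "1 - \<delta> < posterior H f n as xs i" using stop by (auto simp: stop_cond_def)
  note i(2)
  also have "posterior H f n as xs i \<le> posterior H f n as xs m"
    unfolding m_def map_hyp_def using i by (intro argmax_post_ge) auto
  finally have *: "1 - \<delta> < w m / s" using post m by simp
  have "0 \<le> s" unfolding s_def using nn by (intro sum_nonneg) auto
  \<comment> \<open>If \<open>s\<close> were 0, the quotient would be 0 by convention and could not
    exceed \<open>1 - \<delta>\<close>, which is positive.\<close>
  moreover have "s \<noteq> 0" using * \<delta> by auto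
  ultimately have "(1 - \<delta>) * s < w m" using * by (simp add: less_divide_eq)
  moreover have "(\<Sum>j\<in>{..<H} - {m}. w j) = s - w m" unfolding s_def using m by (simp add: sum_diff1)
  ultimately show ?thesis by (simp add: w_def s_def m_def algebra_simps)
qed

end

text \<open>Each \<open>lam h\<close> must separate \<open>h\<close> from the others, as the
  optimisation for \<open>h\<close> guarantees; to pairs avoiding \<open>h\<close> it may be
  blind.\<close>

locale informative_policy = map_policy +
  assumes separated: "h < H \<Longrightarrow> j < H \<Longrightarrow> j \<noteq> h \<Longrightarrow> mixed_affinity h h j < 1"
begin

lemma separation_rate:
  obtains \<gamma> where "\<gamma> < 1" "\<And>h j. h < H \<Longrightarrow> j < H \<Longrightarrow> j \<noteq> h \<Longrightarrow> mixed_affinity h h j \<le> \<gamma>"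
proof -
  \<comment> \<open>The element 0 keeps \<open>R\<close> nonempty when \<open>H = 1\<close>, so that
    \<open>Max R\<close> is meaningful.\<close>
  define R where "R = insert 0 ((\<lambda>(h, j). mixed_affinity h h j) ` {(h, j). h < H \<and> j < H \<and> j \<noteq> h})"
  have "{(h, j). h < H \<and> j < H \<and> j \<noteq> h} \<subseteq> {..<H} \<times> {..<H}" by auto
  then have "finite {(h, j). h < H \<and> j < H \<and> j \<noteq> h}" by (rule finite_subset) simp
  then have fin: "finite R" "R \<noteq> {}" by (auto simp: R_def)
  show thesis
  proof (rule that[of "Max R"])
    have "\<forall>r\<in>R. r < 1" using separated by (auto simp: R_def)
    with fin show "Max R < 1" by simp
    show "mixed_affinity h h j \<le> Max R" if "h < H" "j < H" "j \<noteq> h" for h j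
      using that fin by (intro Max_ge) (auto simp: R_def)
  qed
qed

text \<open>The pairs containing the current maximiser contract, and they carry at least the
  fraction \<open>1 / H\<^sup>2\<close> of the total.\<close>

lemma pair_affinity_contract:
  assumes \<gamma>: "\<gamma> < 1" "\<And>h j. h < H \<Longrightarrow> j < H \<Longrightarrow> j \<noteq> h \<Longrightarrow> mixed_affinity h h j \<le> \<gamma>"
    and h: "h < H" and w: "\<And>i. i < H \<Longrightarrow> 0 \<le> w i" "\<And>i. i < H \<Longrightarrow> w i \<le> w h"
  shows "(\<Sum>i<H. \<Sum>j\<in>{..<H} - {i}. sqrt (w i * w j) * mixed_affinity h i j) \<le>
    (1 - (1 - \<gamma>) / (real H)\<^sup>2) * (\<Sum>i<H. \<Sum>j\<in>{..<H} - {i}. sqrt (w i * w j))"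
proof -
  define T where "T = (\<Sum>j\<in>{..<H} - {h}. sqrt (w h * w j))"
  define U where "U = (\<Sum>i<H. \<Sum>j\<in>{..<H} - {i}. sqrt (w i * w j))"
  have T_ge: "sqrt (w h * w j) \<le> T" if "j < H" "j \<noteq> h" for j
    unfolding T_def using that h w by (intro member_le_sum) auto
  have T0: "0 \<le> T" unfolding T_def using h w by (intro sum_nonneg) auto
  \<comment> \<open>Replacing \<open>i\<close> by the maximiser \<open>h\<close> enlarges the pair,
    which is a term of \<open>T\<close> unless \<open>j = h\<close>; in that case the original pair
    is already one, up to order.\<close>
  have le_T: "sqrt (w i * w j) \<le> T" if "i < H" "j < H" "j \<noteq> i" for i j
  proof (cases "j = h")
    case True
    with T_ge[of i] that show ?thesis by (simp add: mult.commute)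
  next
    case False
    have "sqrt (w i * w j) \<le> sqrt (w h * w j)" using that w by (intro real_sqrt_le_mono mult_right_mono) auto
    also have "\<dots> \<le> T" using T_ge that False by simp
    finally show ?thesis .
  qed
  have "U \<le> (\<Sum>i<H. \<Sum>j\<in>{..<H} - {i}. T)" unfolding U_def using le_T by (intro sum_mono) auto
  also have "\<dots> \<le> (\<Sum>i<H. \<Sum>j<H. T)" using T0 by (intro sum_mono sum_mono2) auto
  also have "\<dots> = (real H)\<^sup>2 * T" by (simp add: power2_eq_square)
  finally have UT: "U / (real H)\<^sup>2 \<le> T" using H_pos by (simp add: divide_le_eq mult.commute)
  \<comment> \<open>Row \<open>h\<close> is contracted by \<open>\<gamma>\<close>; every other row,
    including pairs with \<open>h\<close> in second position, is bounded through
    \<open>mixed_affinity_le_1\<close>. One row suffices because \<open>T\<close> alone carries the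
    fraction \<open>1 / H^2\<close> of \<open>U\<close>.\<close>
  have *: "(\<Sum>j\<in>{..<H} - {i}. sqrt (w i * w j) * mixed_affinity h i j) \<le>
      (\<Sum>j\<in>{..<H} - {i}. sqrt (w i * w j)) - (if i = h then (1 - \<gamma>) * T else 0)" if "i < H" for i
  proof (cases "i = h")
    case True
    have "(\<Sum>j\<in>{..<H} - {h}. sqrt (w h * w j) * mixed_affinity h h j) \<le> (\<Sum>j\<in>{..<H} - {h}. sqrt (w h * w j) * \<gamma>)"
      using \<gamma> h w by (intro sum_mono mult_left_mono) auto
    also have "\<dots> = \<gamma> * T" by (simp add: T_def sum_distrib_left ac_simps)
    also have "\<dots> = T - (1 - \<gamma>) * T" by (simp add: algebra_simps)
    finally show ?thesis using True by (simp add: T_def)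
  next
    case False
    have "(\<Sum>j\<in>{..<H} - {i}. sqrt (w i * w j) * mixed_affinity h i j) \<le> (\<Sum>j\<in>{..<H} - {i}. sqrt (w i * w j) * 1)"
      using that h w by (intro sum_mono mult_left_mono mixed_affinity_le_1) auto
    with False show ?thesis by simp
  qed
  have "(\<Sum>i<H. \<Sum>j\<in>{..<H} - {i}. sqrt (w i * w j) * mixed_affinity h i j) \<le>
      (\<Sum>i<H. (\<Sum>j\<in>{..<H} - {i}. sqrt (w i * w j)) - (if i = h then (1 - \<gamma>) * T else 0))"
    using * by (intro sum_mono) auto
  also have "\<dots> = U - (1 - \<gamma>) * T" using h by (simp add: U_def sum_subtractf)
  also have "\<dots> \<le> U - (1 - \<gamma>) * (U / (real H)\<^sup>2)" using mult_left_mono[OF UT, of "1 - \<gamma>"] \<gamma>(1) by simp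
  also have "\<dots> = (1 - (1 - \<gamma>) / (real H)\<^sup>2) * U" by (simp add: algebra_simps)
  finally show ?thesis by (simp add: U_def)
qed

lemma pair_affinity_decay:
  obtains r where "0 < r" "r < 1"
    "\<And>n. path_integral n (\<lambda>as xs. ennreal (policy_weight n as xs) * ennreal (pair_affinity n as xs)) \<le>
       ennreal (real H * r ^ n)"
proof -
  obtain \<gamma> where \<gamma>: "\<gamma> < 1" "\<And>h j. h < H \<Longrightarrow> j < H \<Longrightarrow> j \<noteq> h \<Longrightarrow> mixed_affinity h h j \<le> \<gamma>"
    using separation_rate by blast
  \<comment> \<open>Nothing bounds \<open>\<gamma>\<close> from below, so the contraction factor
    could be nonpositive; the maximum with \<open>1 / 2\<close> ensures \<open>0 < r\<close>, as
    needed for \<open>ln (1 / r)\<close> in the cost bound.\<close>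
  define r where "r = max (1 / 2) (1 - (1 - \<gamma>) / (real H)\<^sup>2)"
  have r: "0 < r" "r < 1" using \<gamma> H_pos by (auto simp: r_def)
  show thesis
  proof (rule that[OF r])
    fix n
    show "path_integral n (\<lambda>as xs. ennreal (policy_weight n as xs) * ennreal (pair_affinity n as xs)) \<le>
       ennreal (real H * r ^ n)"
    proof (induction n)
      case 0
      \<comment> \<open>There are \<open>H * (H - 1)\<close> ordered pairs, each starting at
        \<open>1 / H\<close>; hence the constant \<open>H\<close> in the bound.\<close>
      have "pair_affinity 0 as xs = real (H - 1)" for as xs
      proof -
        have "pair_affinity 0 as xs = (\<Sum>i<H. \<Sum>j\<in>{..<H} - {i}. 1 / real H)"
          unfolding pair_affinity_def weight_0 real_sqrt_abs2 by simp
        then show ?thesis using H_pos by simp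
      qed
      then show ?case by (simp add: path_integral_0)
    next
      case (Suc n)
      have "path_integral (Suc n) (\<lambda>as xs. ennreal (policy_weight (Suc n) as xs) *
          ennreal (pair_affinity (Suc n) as xs)) \<le>
        path_integral n (\<lambda>as xs. ennreal r * (ennreal (policy_weight n as xs) * ennreal (pair_affinity n as xs)))"
        unfolding path_integral_pair_affinity_Suc
      proof (rule path_integral_mono)
        fix as xs assume as: "as \<in> acts n" and xs: "xs \<in> space (P n)"
        let ?h = "map_hyp n as xs"
        have "(\<Sum>i<H. \<Sum>j\<in>{..<H} - {i}. sqrt (W n as xs i * W n as xs j) * mixed_affinity ?h i j) \<le>
          (1 - (1 - \<gamma>) / (real H)\<^sup>2) * pair_affinity n as xs"
          unfolding pair_affinity_def
          using path_dens_nonneg[OF as xs] path_weight_nonneg[OF as xs]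
          by (intro pair_affinity_contract \<gamma> map_hyp_less)
             (auto simp: map_hyp_def intro!: weight_le_argmax)
        also have "\<dots> \<le> r * pair_affinity n as xs"
          using pair_affinity_nonneg[OF as xs] by (intro mult_right_mono) (auto simp: r_def)
        finally have "ennreal (\<Sum>i<H. \<Sum>j\<in>{..<H} - {i}. sqrt (W n as xs i * W n as xs j) * mixed_affinity ?h i j) \<le>
          ennreal (r * pair_affinity n as xs)" by (rule ennreal_leI)
        also have "\<dots> = ennreal r * ennreal (pair_affinity n as xs)" using r by (simp add: ennreal_mult')
        finally show "ennreal (policy_weight n as xs) *
            ennreal (\<Sum>i<H. \<Sum>j\<in>{..<H} - {i}. sqrt (W n as xs i * W n as xs j) * mixed_affinity ?h i j) \<le>
          ennreal r * (ennreal (policy_weight n as xs) * ennreal (pair_affinity n as xs))"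
          by (subst mult.left_commute) (rule mult_left_mono, auto)
      qed
      also have "\<dots> = ennreal r *
        path_integral n (\<lambda>as xs. ennreal (policy_weight n as xs) * ennreal (pair_affinity n as xs))"
      proof (rule path_integral_cmult)
        fix as assume as: "as \<in> acts n"
        note [measurable] = pair_affinity_measurable[OF as]
          policy_weight_measurable[of n as n, OF acts_less[OF as] order.refl]
        show "(\<lambda>xs. ennreal (policy_weight n as xs) * ennreal (pair_affinity n as xs)) \<in> borel_measurable (P n)"
          by measurable
      qed
      also have "\<dots> \<le> ennreal r * ennreal (real H * r ^ n)" using Suc by (intro mult_left_mono) auto
      also have "\<dots> = ennreal (real H * r ^ Suc n)" using r by (simp add: ennreal_mult'[symmetric] mult.left_commute)
      finally show ?case .
    qed
  qed
qed

end

subsection \<open>Runs of the policy\<close>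

text \<open>The \<open>law\<close> is prescribed on cylinder sets with in-range hypothesis and
  actions. One density expresses the uniform prior, the randomised choice based on the current
  maximiser and the conditional independence of the samples.\<close>

locale policy_run = map_policy \<mu> H K f lam + prob_space M
  for \<mu> :: "'x measure" and H K f lam and M :: "'w measure" +
  fixes \<theta> :: "'w \<Rightarrow> nat" and A :: "nat \<Rightarrow> 'w \<Rightarrow> nat" and X :: "nat \<Rightarrow> 'w \<Rightarrow> 'x"
  assumes hyp_measurable [measurable]: "\<theta> \<in> measurable M (count_space UNIV)"
    and action_measurable [measurable]: "A k \<in> measurable M (count_space UNIV)"
    and sample_measurable [measurable]: "X k \<in> measurable M \<mu>"
    and law: "h < H \<Longrightarrow> (\<And>k. k < n \<Longrightarrow> as k < K) \<Longrightarrow> (\<And>k. k < n \<Longrightarrow> Bs k \<in> sets \<mu>) \<Longrightarrow>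
      emeasure M {\<omega> \<in> space M. \<theta> \<omega> = h \<and> (\<forall>k<n. A k \<omega> = as k \<and> X k \<omega> \<in> Bs k)} =
      (\<integral>\<^sup>+ xs. ennreal ((1 / real H) * (\<Prod>k<n. indicator (Bs k) (xs k) *
         lam (argmax_post H (posterior H f k as xs)) (as k) * f h (as k) (xs k))) \<partial>P n)"
begin

abbreviation samples :: "nat \<Rightarrow> 'w \<Rightarrow> nat \<Rightarrow> 'x" where
  "samples n \<omega> \<equiv> restrict (\<lambda>k. X k \<omega>) {..<n}"

lemma samples_measurable [measurable]: "samples n \<in> measurable M (P n)"
  by (intro measurable_restrict) simp

definition path_event :: "nat \<Rightarrow> nat \<Rightarrow> (nat \<Rightarrow> nat) \<Rightarrow> 'w set" where
  "path_event n h as = {\<omega> \<in> space M. \<theta> \<omega> = h \<and> (\<forall>k<n. A k \<omega> = as k)}"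

lemma path_event_sets [measurable]: "path_event n h as \<in> sets M"
  unfolding path_event_def by measurable

lemma path_density_measurable:
  assumes "as \<in> acts n" "h < H"
  shows "(\<lambda>xs. ennreal (policy_weight n as xs) * ennreal (W n as xs h)) \<in> borel_measurable (P n)"
proof -
  note [measurable] = weight_measurable_acts[OF assms]
    policy_weight_measurable[of n as n, OF acts_less[OF assms(1)] order.refl]
  show ?thesis by measurable
qed

text \<open>The law fixes both measures on boxes, which generate the product sigma-algebra and are
  closed under intersection; finite measures agreeing there are equal.\<close>

lemma distr_samples:
  assumes as: "as \<in> acts n" and h: "h < H"
  shows "distr (density M (indicator (path_event n h as))) (P n) (samples n) =
    density (P n) (\<lambda>xs. ennreal (policy_weight n as xs) * ennreal (W n as xs h))" (is "?N = ?Q")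
proof (rule measure_eqI_PiM_finite)
  fix Bs :: "nat \<Rightarrow> 'x set" assume Bs: "\<And>k. k \<in> {..<n} \<Longrightarrow> Bs k \<in> sets \<mu>"
  have PiE_sets [measurable]: "PiE {..<n} Bs \<in> sets (P n)"
    using Bs by (intro sets_PiM_I_finite) auto
  have "emeasure ?N (PiE {..<n} Bs) =
      emeasure M (path_event n h as \<inter> (samples n -` PiE {..<n} Bs \<inter> space M))"
  proof -
    have [measurable]: "samples n -` PiE {..<n} Bs \<inter> space M \<in> sets M"
      by (rule measurable_sets[OF samples_measurable PiE_sets])
    show ?thesis
      by (simp add: emeasure_distr emeasure_density indicator_inter_arith[symmetric])
  qed
  also have "path_event n h as \<inter> (samples n -` PiE {..<n} Bs \<inter> space M) =
      {\<omega> \<in> space M. \<theta> \<omega> = h \<and> (\<forall>k<n. A k \<omega> = as k \<and> X k \<omega> \<in> Bs k)}"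
    by (auto simp: path_event_def PiE_iff)
  also have "emeasure M \<dots> = (\<integral>\<^sup>+ xs. ennreal ((1 / real H) * (\<Prod>k<n. indicator (Bs k) (xs k) *
         lam (argmax_post H (posterior H f k as xs)) (as k) * f h (as k) (xs k))) \<partial>P n)"
    using as h Bs by (intro law) auto
  also have "\<dots> = (\<integral>\<^sup>+ xs. ennreal (policy_weight n as xs) * ennreal (W n as xs h) *
      indicator (PiE {..<n} Bs) xs \<partial>P n)"
  proof (rule nn_integral_cong)
    fix xs assume xs: "xs \<in> space (P n)"
    have ind: "(\<Prod>k<n. indicator (Bs k) (xs k)) = (indicator (PiE {..<n} Bs) xs :: real)"
    proof (cases "xs \<in> PiE {..<n} Bs")
      case False
      then obtain k where "k < n" "xs k \<notin> Bs k"
        using xs by (auto simp: PiE_iff space_PiM)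
      then have "(\<Prod>k<n. indicator (Bs k) (xs k)) = (0 :: real)"
        by (intro prod_zero) (auto intro!: bexI[of _ k])
      with False show ?thesis by simp
    qed (auto intro!: prod.neutral simp: PiE_iff)
    have "(1 / real H) * (\<Prod>k<n. indicator (Bs k) (xs k) *
         lam (argmax_post H (posterior H f k as xs)) (as k) * f h (as k) (xs k)) =
       policy_weight n as xs * W n as xs h * indicator (PiE {..<n} Bs) xs"
      by (simp add: prod.distrib ind policy_weight_def weight_def map_hyp_def ac_simps)
    moreover have "0 \<le> policy_weight n as xs" "0 \<le> W n as xs h"
      using as h xs by (auto intro!: policy_weight_nonneg path_weight_nonneg)
    ultimately show "ennreal ((1 / real H) * (\<Prod>k<n. indicator (Bs k) (xs k) *
         lam (argmax_post H (posterior H f k as xs)) (as k) * f h (as k) (xs k))) =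
       ennreal (policy_weight n as xs) * ennreal (W n as xs h) * indicator (PiE {..<n} Bs) xs"
      by (simp add: ennreal_mult split: split_indicator)
  qed
  also have "\<dots> = emeasure ?Q (PiE {..<n} Bs)"
    using path_density_measurable[OF as h] by (simp add: emeasure_density)
  finally show "emeasure ?N (PiE {..<n} Bs) = emeasure ?Q (PiE {..<n} Bs)" .
next
  \<comment> \<open>The whole space serves as the exhausting sequence: it has finite mass under
    \<open>?N\<close>, although \<open>\<mu>\<close> may be infinite.\<close>
  show "range (\<lambda>_. space (P n)) \<subseteq> prod_algebra {..<n} (\<lambda>_. \<mu>)"
    by (auto simp: space_PiM intro!: prod_algebraI_finite)
  have [measurable]: "samples n -` space (P n) \<inter> space M \<in> sets M"
    by (rule measurable_sets[OF samples_measurable sets.top])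
  have "emeasure ?N (space (P n)) = emeasure M (path_event n h as \<inter> (samples n -` space (P n) \<inter> space M))"
    by (simp add: emeasure_distr emeasure_density indicator_inter_arith[symmetric])
  also have "\<dots> \<le> emeasure M (space M)" by (rule emeasure_space)
  finally show "emeasure ?N (space (P n)) \<noteq> \<infinity>" by (auto simp: emeasure_space_1 top_unique)
qed auto

lemma path_event_integral:
  assumes as: "as \<in> acts n" and h: "h < H" and [measurable]: "F \<in> borel_measurable (P n)"
  shows "(\<integral>\<^sup>+ \<omega>. indicator (path_event n h as) \<omega> * F (samples n \<omega>) \<partial>M) =
    (\<integral>\<^sup>+ xs. ennreal (policy_weight n as xs) * (ennreal (W n as xs h) * F xs) \<partial>P n)"
proof -
  have "(\<integral>\<^sup>+ \<omega>. indicator (path_event n h as) \<omega> * F (samples n \<omega>) \<partial>M) =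
      (\<integral>\<^sup>+ xs. F xs \<partial>distr (density M (indicator (path_event n h as))) (P n) (samples n))"
    by (subst nn_integral_distr) (auto simp: nn_integral_density)
  also have "\<dots> = (\<integral>\<^sup>+ xs. ennreal (policy_weight n as xs) * ennreal (W n as xs h) * F xs \<partial>P n)"
    unfolding distr_samples[OF as h] using path_density_measurable[OF as h]
    by (subst nn_integral_density) auto
  finally show ?thesis by (simp add: mult.assoc)
qed

lemma path_event_disjoint:
  assumes "as \<in> acts n" "as' \<in> acts n" "\<omega> \<in> path_event n h as" "\<omega> \<in> path_event n h' as'"
  shows "h = h'" "as = as'"
proof -
  show "h = h'" using assms by (simp add: path_event_def)
  show "as = as'"
  proof (rule PiE_ext[OF assms(1,2)])
    fix k assume "k \<in> {..<n}"
    with assms(3,4) show "as k = as' k" by (simp add: path_event_def)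
  qed
qed

text \<open>The events of in-range paths are disjoint, and by \<open>path_mass\<close> their
  probabilities add up to \<open>H * (1 / H) = 1\<close>, so nothing is left for other values. A
  countable intersection covers all times.\<close>

lemma AE_in_range: "AE \<omega> in M. \<theta> \<omega> < H \<and> (\<forall>k. A k \<omega> < K)"
proof -
  have "AE \<omega> in M. \<theta> \<omega> < H \<and> (\<forall>k<n. A k \<omega> < K)" for n
  proof -
    define E where "E = {\<omega> \<in> space M. \<theta> \<omega> < H \<and> (\<forall>k<n. A k \<omega> < K)}"
    have E: "indicator E \<omega> = (\<Sum>h<H. \<Sum>as\<in>acts n. indicator (path_event n h as) \<omega> :: ennreal)"
      if "\<omega> \<in> space M" for \<omega>
    proof (cases "\<omega> \<in> E")
      case True
      let ?as = "restrict (\<lambda>k. A k \<omega>) {..<n}"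
      have as: "?as \<in> acts n" using True by (auto simp: E_def)
      have "(\<Sum>h<H. \<Sum>as\<in>acts n. indicator (path_event n h as) \<omega> :: ennreal) =
          (\<Sum>h<H. \<Sum>as\<in>acts n. if h = \<theta> \<omega> \<and> as = ?as then 1 else 0)"
      proof (intro sum.cong refl)
        fix h as assume "as \<in> acts n"
        have "\<omega> \<in> path_event n (\<theta> \<omega>) ?as" using that by (simp add: path_event_def)
        then have "\<omega> \<in> path_event n h as \<longleftrightarrow> h = \<theta> \<omega> \<and> as = ?as"
          using path_event_disjoint[OF \<open>as \<in> acts n\<close> as] by blast
        then show "indicator (path_event n h as) \<omega> = (if h = \<theta> \<omega> \<and> as = ?as then 1 else 0 :: ennreal)"
          by (simp add: indicator_def)
      qed
      also have "\<dots> = (\<Sum>h<H. if h = \<theta> \<omega> then \<Sum>as\<in>acts n. if as = ?as then 1 else 0 else 0)"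
        by (intro sum.cong refl) auto
      also have "\<dots> = 1" using True as by (simp add: finite_PiE E_def)
      finally show ?thesis using True by simp
    next
      case False
      then have "\<omega> \<notin> path_event n h as" if "h < H" "as \<in> acts n" for h as
        using that acts_less[OF that(2)] by (fastforce simp: E_def path_event_def)
      with False show ?thesis by simp
    qed
    have "emeasure M E = (\<integral>\<^sup>+ \<omega>. indicator E \<omega> \<partial>M)" by (simp add: E_def)
    also have "\<dots> = (\<integral>\<^sup>+ \<omega>. (\<Sum>h<H. \<Sum>as\<in>acts n. indicator (path_event n h as) \<omega>) \<partial>M)"
      using E by (intro nn_integral_cong) auto
    also have "\<dots> = (\<Sum>h<H. \<Sum>as\<in>acts n. \<integral>\<^sup>+ \<omega>. indicator (path_event n h as) \<omega> \<partial>M)"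
      by (simp add: nn_integral_sum)
    also have "\<dots> = (\<Sum>h<H. path_integral n (\<lambda>as xs. ennreal (policy_weight n as xs) * ennreal (W n as xs h)))"
      unfolding path_integral_def
      using path_event_integral[where F = "\<lambda>_. 1"] by (intro sum.cong refl) auto
    also have "\<dots> = (\<Sum>h<H. ennreal (1 / real H))" using path_mass by (intro sum.cong) auto
    also have "\<dots> = ennreal (\<Sum>h<H. 1 / real H)" by (rule sum_ennreal) simp
    also have "\<dots> = 1" using H_pos by simp
    finally have "emeasure M E = 1" .
    then show ?thesis
      by (intro AE_I_eq_1) (auto simp: E_def)
  qed
  then have "AE \<omega> in M. \<forall>n. \<theta> \<omega> < H \<and> (\<forall>k<n. A k \<omega> < K)" by (simp add: AE_all_countable)
  then show ?thesis by eventually_elim blast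
qed

end

section \<open>Expectations along a run with in-range values\<close>

locale bounded_run = policy_run +
  assumes hyp_less: "\<omega> \<in> space M \<Longrightarrow> \<theta> \<omega> < H"
    and action_less: "\<omega> \<in> space M \<Longrightarrow> A k \<omega> < K"
begin

abbreviation as_of where "as_of \<omega> \<equiv> (\<lambda>k. A k \<omega>)"
abbreviation xs_of where "xs_of \<omega> \<equiv> (\<lambda>k. X k \<omega>)"

text \<open>Bridge from runs to path integrals. In-range values make the path events a partition of
  the sample space; on each of them locality (\<open>cong\<close>) turns \<open>F\<close> into a
  function of \<open>samples n\<close> for fixed \<open>h\<close> and \<open>as\<close>, so no joint
  measurability is asked for.\<close>

lemma expectation_path:
  assumes meas: "\<And>h as. h < H \<Longrightarrow> as \<in> acts n \<Longrightarrow> F h as \<in> borel_measurable (P n)"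
    and cong: "\<And>h as as' xs xs'. (\<And>k. k < n \<Longrightarrow> as k = as' k) \<Longrightarrow> (\<And>k. k < n \<Longrightarrow> xs k = xs' k) \<Longrightarrow>
       F h as xs = F h as' xs'"
  shows "(\<integral>\<^sup>+ \<omega>. F (\<theta> \<omega>) (as_of \<omega>) (xs_of \<omega>) \<partial>M) =
    path_integral n (\<lambda>as xs. ennreal (policy_weight n as xs) * (\<Sum>h<H. ennreal (W n as xs h) * F h as xs))"
proof -
  have F: "F (\<theta> \<omega>) (as_of \<omega>) (xs_of \<omega>) =
      (\<Sum>h<H. \<Sum>as\<in>acts n. indicator (path_event n h as) \<omega> * F h as (samples n \<omega>))"
    if "\<omega> \<in> space M" for \<omega>
  proof -
    let ?as = "restrict (as_of \<omega>) {..<n}"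
    have as: "?as \<in> acts n" using action_less[OF that] by auto
    have "(\<Sum>h<H. \<Sum>as\<in>acts n. indicator (path_event n h as) \<omega> * F h as (samples n \<omega>)) =
        (\<Sum>h<H. \<Sum>as\<in>acts n. if h = \<theta> \<omega> \<and> as = ?as then F (\<theta> \<omega>) ?as (samples n \<omega>) else 0)"
    proof (intro sum.cong refl)
      fix h as assume "as \<in> acts n"
      have "\<omega> \<in> path_event n (\<theta> \<omega>) ?as" using that by (simp add: path_event_def)
      then have "\<omega> \<in> path_event n h as \<longleftrightarrow> h = \<theta> \<omega> \<and> as = ?as"
        using path_event_disjoint[OF \<open>as \<in> acts n\<close> as] by blast
      then show "indicator (path_event n h as) \<omega> * F h as (samples n \<omega>) =
          (if h = \<theta> \<omega> \<and> as = ?as then F (\<theta> \<omega>) ?as (samples n \<omega>) else 0)"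
        by (simp add: indicator_def)
    qed
    also have "\<dots> = (\<Sum>h<H. if h = \<theta> \<omega> then \<Sum>as\<in>acts n. if as = ?as then F (\<theta> \<omega>) ?as (samples n \<omega>) else 0 else 0)"
      by (intro sum.cong refl) auto
    also have "\<dots> = F (\<theta> \<omega>) ?as (samples n \<omega>)" using hyp_less[OF that] as by (simp add: finite_PiE)
    also have "\<dots> = F (\<theta> \<omega>) (as_of \<omega>) (xs_of \<omega>)" by (rule cong) simp_all
    finally show ?thesis by simp
  qed
  have meas': "(\<lambda>\<omega>. indicator (path_event n h as) \<omega> * F h as (samples n \<omega>)) \<in> borel_measurable M"
    if "h < H" "as \<in> acts n" for h as
    using meas[OF that] by measurable
  have dens: "(\<lambda>xs. ennreal (policy_weight n as xs) * (ennreal (W n as xs h) * F h as xs)) \<in> borel_measurable (P n)"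
    if "h < H" "as \<in> acts n" for h as
    using path_density_measurable[OF that(2,1)] meas[OF that]
    unfolding mult.assoc[symmetric] by measurable
  have "(\<integral>\<^sup>+ \<omega>. F (\<theta> \<omega>) (as_of \<omega>) (xs_of \<omega>) \<partial>M) =
      (\<integral>\<^sup>+ \<omega>. (\<Sum>h<H. \<Sum>as\<in>acts n. indicator (path_event n h as) \<omega> * F h as (samples n \<omega>)) \<partial>M)"
    by (intro nn_integral_cong F)
  also have "\<dots> = (\<Sum>h<H. \<Sum>as\<in>acts n. \<integral>\<^sup>+ \<omega>. indicator (path_event n h as) \<omega> * F h as (samples n \<omega>) \<partial>M)"
    using meas' by (subst nn_integral_sum, force intro!: borel_measurable_sum)
      (intro sum.cong refl nn_integral_sum, auto)
  also have "\<dots> = (\<Sum>h<H. path_integral n (\<lambda>as xs. ennreal (policy_weight n as xs) * (ennreal (W n as xs h) * F h as xs)))"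
    unfolding path_integral_def by (intro sum.cong refl path_event_integral meas) auto
  also have "\<dots> = path_integral n (\<lambda>as xs. \<Sum>h<H. ennreal (policy_weight n as xs) * (ennreal (W n as xs h) * F h as xs))"
    using dens by (intro path_integral_sum[symmetric]) auto
  finally show ?thesis by (simp add: sum_distrib_left)
qed

text \<open>The random index is resolved by a finite sum over actions. As \<open>G a\<close> is
  measurable for \<open>a < K\<close>, the actions must be in range everywhere and not just almost
  surely.\<close>

lemma action_sample_measurable:
  fixes G :: "nat \<Rightarrow> _ \<Rightarrow> real"
  assumes "\<And>a. a < K \<Longrightarrow> G a \<in> borel_measurable \<mu>"
  shows "(\<lambda>\<omega>. G (A k \<omega>) (X k \<omega>)) \<in> borel_measurable M"
proof -
  have [measurable]: "(\<lambda>\<omega>. G a (X k \<omega>)) \<in> borel_measurable M" if "a < K" for a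
    using sample_measurable assms[OF that] by (rule measurable_compose)
  have "(\<lambda>\<omega>. \<Sum>a<K. if A k \<omega> = a then G a (X k \<omega>) else 0) \<in> borel_measurable M" by measurable
  also have "?this \<longleftrightarrow> ?thesis"
    using action_less by (intro measurable_cong) simp
  finally show ?thesis .
qed

lemma run_posterior_measurable:
  "i < H \<Longrightarrow> (\<lambda>\<omega>. posterior H f n (as_of \<omega>) (xs_of \<omega>) i) \<in> borel_measurable M"
proof (induction n arbitrary: i)
  case (Suc n)
  note [measurable] = Suc.IH
  have [measurable]: "(\<lambda>\<omega>. f h (A n \<omega>) (X n \<omega>)) \<in> borel_measurable M" if "h < H" for h
    using that by (intro action_sample_measurable) simp
  show ?case using Suc.prems by simp
qed simp

lemma run_stop_cond_measurable [measurable]: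
  "Measurable.pred M (\<lambda>\<omega>. stop_cond H f \<delta> (as_of \<omega>) (xs_of \<omega>) n)"
proof -
  note [measurable] = run_posterior_measurable
  have "Measurable.pred M (\<lambda>\<omega>. \<exists>i\<in>{..<H}. 1 - \<delta> < posterior H f n (as_of \<omega>) (xs_of \<omega>) i)"
    by (intro pred_intros_finite) auto
  then show ?thesis unfolding stop_cond_def by (simp add: Bex_def)
qed

lemma run_map_hyp_measurable [measurable]:
  "(\<lambda>\<omega>. map_hyp n (as_of \<omega>) (xs_of \<omega>)) \<in> measurable M (count_space UNIV)"
  unfolding map_hyp_def by (rule argmax_post_measurable) (rule run_posterior_measurable)

text \<open>Indices start at 0: a run that stops at time \<open>N\<close> has seen \<open>N\<close>
  samples and paid for \<open>A 0\<close> to \<open>A (N - 1)\<close>. Never stopping has infinite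
  cost.\<close>

definition run_cost where
  "run_cost c \<delta> \<omega> = (if \<exists>n. stop_cond H f \<delta> (as_of \<omega>) (xs_of \<omega>) n
     then ennreal (\<Sum>k < stop_time H f \<delta> (as_of \<omega>) (xs_of \<omega>). c (A k \<omega>)) else \<infinity>)"

lemma stop_time_le: "stop_cond H f \<delta> as xs n \<Longrightarrow> stop_time H f \<delta> as xs \<le> n"
  unfolding stop_time_def by (rule Least_le)

lemma stop_time_stops: "stop_cond H f \<delta> as xs n \<Longrightarrow> stop_cond H f \<delta> as xs (stop_time H f \<delta> as xs)"
  unfolding stop_time_def by (rule LeastI)

text \<open>Used with the indicator of a vanishing likelihood and with \<open>abs_llr\<close>; both
  need the same right-hand side at every time \<open>m\<close>.\<close>

lemma expectation_last_le:
  assumes G: "\<And>a. a < K \<Longrightarrow> G a \<in> borel_measurable \<mu>"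
  shows "(\<integral>\<^sup>+ \<omega>. G (A m \<omega>) (X m \<omega>) \<partial>M) \<le> (\<Sum>h<H. \<Sum>a<K. \<integral>\<^sup>+ x. ennreal (f h a x) * G a x \<partial>\<mu>)"
proof -
  define F where "F h a as xs = ennreal (policy_weight (Suc m) as xs) *
      (ennreal (W (Suc m) as xs h) * (if as m = a then G a (xs m) else 0))" for h a as xs
  have meas: "F h a as \<in> borel_measurable (P (Suc m))" if "h < H" "a < K" "as \<in> acts (Suc m)" for h a as
  proof -
    note [measurable] = path_density_measurable[OF that(3,1)] last_sample_measurable[OF G[OF that(2)], of m]
    show ?thesis unfolding F_def mult.assoc[symmetric] by measurable
  qed
  have "(\<integral>\<^sup>+ \<omega>. G (A m \<omega>) (X m \<omega>) \<partial>M) = path_integral (Suc m) (\<lambda>as xs.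
      ennreal (policy_weight (Suc m) as xs) * (\<Sum>h<H. ennreal (W (Suc m) as xs h) * G (as m) (xs m)))"
    by (rule expectation_path[where F = "\<lambda>h as xs. G (as m) (xs m)"])
       (simp_all add: last_sample_measurable G acts_less)
  also have "\<dots> = path_integral (Suc m) (\<lambda>as xs. \<Sum>h<H. \<Sum>a<K. F h a as xs)"
  proof (rule path_integral_cong)
    fix as xs assume "as \<in> acts (Suc m)"
    then have am: "as m < K" by (rule acts_less) simp
    have "(\<Sum>a<K. F h a as xs) = (\<Sum>a<K. if as m = a then ennreal (policy_weight (Suc m) as xs) *
        (ennreal (W (Suc m) as xs h) * G a (xs m)) else 0)" for h
      by (intro sum.cong) (auto simp: F_def)
    then have "(\<Sum>a<K. F h a as xs) = ennreal (policy_weight (Suc m) as xs) *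
        (ennreal (W (Suc m) as xs h) * G (as m) (xs m))" for h
      using am by (simp del: weight_Suc policy_weight_Suc)
    then show "ennreal (policy_weight (Suc m) as xs) * (\<Sum>h<H. ennreal (W (Suc m) as xs h) * G (as m) (xs m)) =
        (\<Sum>h<H. \<Sum>a<K. F h a as xs)"
      by (simp only: sum_distrib_left)
  qed
  also have "\<dots> = (\<Sum>h<H. path_integral (Suc m) (\<lambda>as xs. \<Sum>a<K. F h a as xs))"
    using meas by (intro path_integral_sum borel_measurable_sum) auto
  also have "\<dots> = (\<Sum>h<H. \<Sum>a<K. path_integral (Suc m) (F h a))"
    using meas by (intro sum.cong refl path_integral_sum) auto
  also have "\<dots> \<le> (\<Sum>h<H. \<Sum>a<K. \<integral>\<^sup>+ x. ennreal (f h a x) * G a x \<partial>\<mu>)"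
  proof (intro sum_mono)
    fix h a assume "h \<in> {..<H}" "a \<in> {..<K}"
    then have ha: "h < H" "a < K" by auto
    have "F h a = (\<lambda>as xs. ennreal (policy_weight (Suc m) as xs) *
      (ennreal (W (Suc m) as xs h) * (if as m = a then G a (xs m) else 0)))"
      by (intro ext) (simp only: F_def)
    then show "path_integral (Suc m) (F h a) \<le> (\<integral>\<^sup>+ x. ennreal (f h a x) * G a x \<partial>\<mu>)"
      using path_integral_last_le[OF ha G[OF ha(2)], of m] by (simp only:)
  qed
  finally show ?thesis .
qed

section \<open>Log-likelihood ratios at stopping\<close>

definition abs_llr where
  "abs_llr a x = (\<Sum>i<H. \<Sum>j<H. \<bar>log 2 (f i a x / f j a x)\<bar>)"

lemma abs_llr_nonneg: "0 \<le> abs_llr a x"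
  unfolding abs_llr_def by (intro sum_nonneg) auto

lemma abs_llr_measurable:
  assumes "a < K"
  shows "abs_llr a \<in> borel_measurable \<mu>"
proof -
  have [measurable]: "f h a \<in> borel_measurable \<mu>" if "h < H" for h using that assms by simp
  show ?thesis unfolding abs_llr_def by measurable
qed

text \<open>The priors cancel and the logarithm turns products into sums over time. As
  \<open>abs_llr\<close> adds up all ordered pairs, one bound serves whichever pair matters at
  stopping.\<close>

lemma weight_ratio_log_le:
  assumes pos: "\<And>k j. k < n \<Longrightarrow> j < H \<Longrightarrow> 0 < f j (as k) (xs k)" and i: "i < H" and j: "j < H"
  shows "log 2 (W n as xs i / W n as xs j) \<le> (\<Sum>k<n. abs_llr (as k) (xs k))"
  using pos
proof (induction n)
  case 0
  then show ?case using H_pos by simp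
next
  case (Suc n)
  have W: "0 < W n as xs i" "0 < W n as xs j"
    using Suc.prems i j H_pos by (auto intro!: weight_pos)
  have fpos: "0 < f i (as n) (xs n)" "0 < f j (as n) (xs n)" using Suc.prems i j by auto
  have "log 2 (W (Suc n) as xs i / W (Suc n) as xs j) =
      log 2 ((W n as xs i / W n as xs j) * (f i (as n) (xs n) / f j (as n) (xs n)))" by simp
  also have "\<dots> = log 2 (W n as xs i / W n as xs j) + log 2 (f i (as n) (xs n) / f j (as n) (xs n))"
    using W fpos by (intro log_mult_pos) auto
  also have "log 2 (f i (as n) (xs n) / f j (as n) (xs n)) \<le> abs_llr (as n) (xs n)"
  proof -
    have "log 2 (f i (as n) (xs n) / f j (as n) (xs n)) \<le> (\<Sum>j<H. \<bar>log 2 (f i (as n) (xs n) / f j (as n) (xs n))\<bar>)"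
      using j by (intro order_trans[OF abs_ge_self member_le_sum[where f = "\<lambda>j. \<bar>log 2 (f i (as n) (xs n) / f j (as n) (xs n))\<bar>"]]) auto
    also have "\<dots> \<le> abs_llr (as n) (xs n)" unfolding abs_llr_def
      using i by (intro member_le_sum[where f = "\<lambda>i. \<Sum>j<H. \<bar>log 2 (f i (as n) (xs n) / f j (as n) (xs n))\<bar>"] sum_nonneg) auto
    finally show ?thesis .
  qed
  finally show ?case using Suc by simp
qed

text \<open>A winner \<open>i\<close> with more than the fraction \<open>1 - \<delta>\<close> leaves
  at most \<open>\<delta>\<close> to a rival \<open>j\<close>, so their ratio is at least
  \<open>(1 - \<delta>) / \<delta>\<close>. In the application \<open>m\<close> is random;
  nonnegative summands move the bound to the fixed horizon \<open>n\<close>.\<close>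

lemma stop_cond_imp_abs_llr:
  assumes pos: "\<And>k j. k < n \<Longrightarrow> j < H \<Longrightarrow> 0 < f j (as k) (xs k)" and m: "m < n"
    and stop: "stop_cond H f \<delta> as xs m" and \<delta>: "0 < \<delta>" "\<delta> < 1" and H: "2 \<le> H"
  shows "log 2 ((1 - \<delta>) / \<delta>) \<le> (\<Sum>k<n. abs_llr (as k) (xs k))"
proof -
  define w where "w = W m as xs"
  define s where "s = (\<Sum>h<H. w h)"
  have w: "0 < w h" if "h < H" for h
    unfolding w_def using pos m that H_pos by (intro weight_pos) auto
  obtain i where i: "i < H" "1 - \<delta> < posterior H f m as xs i" using stop by (auto simp: stop_cond_def)
  have "posterior H f m as xs i = w i / s"
    unfolding w_def s_def using pos m i by (intro posterior_eq_weight) (auto intro: less_imp_le)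
  with i have wi: "1 - \<delta> < w i / s" by simp
  define j where "j = (if i = 0 then 1 else 0 :: nat)"
  have j: "j < H" "j \<noteq> i" using H by (auto simp: j_def)
  have s: "0 < s" unfolding s_def using w H_pos by (intro sum_pos) auto
  have "w i + w j = sum w {i, j}" using j by auto
  also have "\<dots> \<le> s" unfolding s_def using i j w by (intro sum_mono2) (auto intro: less_imp_le)
  finally have ij: "w i + w j \<le> s" .
  have wi': "(1 - \<delta>) * s < w i" using wi s by (simp add: less_divide_eq)
  with ij have wj': "w j \<le> \<delta> * s" by (simp add: algebra_simps)
  have "(1 - \<delta>) * w j \<le> (1 - \<delta>) * (\<delta> * s)" using wj' \<delta> by (intro mult_left_mono) auto
  also have "\<dots> = \<delta> * ((1 - \<delta>) * s)" by simp
  also have "\<dots> \<le> \<delta> * w i" using wi' \<delta> by (intro mult_left_mono) auto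
  finally have "(1 - \<delta>) / \<delta> \<le> w i / w j" using \<delta> w[OF j(1)] by (simp add: field_simps)
  then have "log 2 ((1 - \<delta>) / \<delta>) \<le> log 2 (w i / w j)"
    using \<delta> w[OF j(1)] w[OF i(1)] by (subst log_le_cancel_iff) auto
  also have "\<dots> \<le> (\<Sum>k<m. abs_llr (as k) (xs k))"
    unfolding w_def using pos m i j by (intro weight_ratio_log_le) auto
  also have "\<dots> \<le> (\<Sum>k<n. abs_llr (as k) (xs k))"
    using m abs_llr_nonneg by (intro sum_mono2) auto
  finally show ?thesis .
qed

end

subsection \<open>Error probability and upper bound on the cost\<close>

locale informative_run = bounded_run + informative_policy
begin

text \<open>\<open>stop_time\<close> is a \<open>LEAST\<close> over all times and carries no
  information on runs that never stop. This event involves times up to \<open>n\<close> only and so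
  lives on \<open>acts n\<close> and \<open>P n\<close>.\<close>

definition first_stop where
  "first_stop \<delta> n as xs \<longleftrightarrow> stop_cond H f \<delta> as xs n \<and> (\<forall>m<n. \<not> stop_cond H f \<delta> as xs m)"

lemma first_stop_cong:
  assumes "\<And>k. k < n \<Longrightarrow> as k = as' k" "\<And>k. k < n \<Longrightarrow> xs k = xs' k"
  shows "first_stop \<delta> n as xs = first_stop \<delta> n as' xs'"
proof -
  have "stop_cond H f \<delta> as xs m = stop_cond H f \<delta> as' xs' m" if "m \<le> n" for m
    using assms that by (intro stop_cond_cong) auto
  then show ?thesis by (auto simp: first_stop_def)
qed

lemma first_stop_measurable:
  assumes "as \<in> acts n"
  shows "Measurable.pred (P n) (first_stop \<delta> n as)"
proof -
  have [measurable]: "Measurable.pred (P n) (\<lambda>xs. stop_cond H f \<delta> as xs m)" if "m \<le> n" for m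
    using that acts_less[OF assms] by (intro stop_cond_measurable) auto
  have "Measurable.pred (P n) (\<lambda>xs. \<forall>m\<in>{..<n}. \<not> stop_cond H f \<delta> as xs m)"
    by (intro pred_intros_finite) auto
  then have [measurable]: "Measurable.pred (P n) (\<lambda>xs. \<forall>m<n. \<not> stop_cond H f \<delta> as xs m)"
    by (simp add: Ball_def)
  show ?thesis unfolding first_stop_def by measurable
qed

lemma run_first_stop_measurable [measurable]:
  "Measurable.pred M (\<lambda>\<omega>. first_stop \<delta> n (as_of \<omega>) (xs_of \<omega>))"
  unfolding first_stop_def by measurable

lemma sets_Collect_first_stop_error:
  "{\<omega> \<in> space M. first_stop \<delta> n (as_of \<omega>) (xs_of \<omega>) \<and> map_hyp n (as_of \<omega>) (xs_of \<omega>) \<noteq> \<theta> \<omega>} \<in> sets M"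
proof -
  have "Measurable.pred M (\<lambda>\<omega>. first_stop \<delta> n (as_of \<omega>) (xs_of \<omega>) \<and>
      (\<forall>h. \<theta> \<omega> = h \<longrightarrow> map_hyp n (as_of \<omega>) (xs_of \<omega>) \<noteq> h))"
    by measurable
  then show ?thesis by (simp add: pred_def)
qed

text \<open>Given actions and samples, the error probability is the posterior mass off the
  maximiser, which \<open>stopped_error_weight\<close> bounds by \<open>\<delta>\<close>. The bound
  is proportional to the probability of stopping first at \<open>n\<close>; these events are
  disjoint, so the sum over \<open>n\<close> is still at most \<open>\<delta>\<close>.\<close>

lemma emeasure_first_stop_error:
  assumes \<delta>: "0 < \<delta>" "\<delta> < 1"
  shows "emeasure M {\<omega> \<in> space M. first_stop \<delta> n (as_of \<omega>) (xs_of \<omega>) \<and> map_hyp n (as_of \<omega>) (xs_of \<omega>) \<noteq> \<theta> \<omega>} \<le>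
    ennreal \<delta> * emeasure M {\<omega> \<in> space M. first_stop \<delta> n (as_of \<omega>) (xs_of \<omega>)}"
proof -
  define F1 :: "nat \<Rightarrow> _ \<Rightarrow> _ \<Rightarrow> ennreal" where
    "F1 h as xs = (if first_stop \<delta> n as xs \<and> map_hyp n as xs \<noteq> h then 1 else 0)" for h as xs
  define F2 :: "nat \<Rightarrow> _ \<Rightarrow> _ \<Rightarrow> ennreal" where
    "F2 h as xs = (if first_stop \<delta> n as xs then 1 else 0)" for h as xs
  have meas: "F1 h as \<in> borel_measurable (P n)" "F2 h as \<in> borel_measurable (P n)" if "as \<in> acts n" for h as
  proof -
    note [measurable] = first_stop_measurable[OF that, of \<delta>]
      map_hyp_measurable[of n as n, OF acts_less[OF that] order.refl]
    show "F1 h as \<in> borel_measurable (P n)" "F2 h as \<in> borel_measurable (P n)"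
      unfolding F1_def F2_def by measurable
  qed
  have cong: "F1 h as xs = F1 h as' xs'" "F2 h as xs = F2 h as' xs'"
    if "\<And>k. k < n \<Longrightarrow> as k = as' k" "\<And>k. k < n \<Longrightarrow> xs k = xs' k" for h as as' xs xs'
    using first_stop_cong[OF that] map_hyp_cong[OF that] by (simp_all add: F1_def F2_def)
  have "emeasure M {\<omega> \<in> space M. first_stop \<delta> n (as_of \<omega>) (xs_of \<omega>) \<and> map_hyp n (as_of \<omega>) (xs_of \<omega>) \<noteq> \<theta> \<omega>} =
      (\<integral>\<^sup>+ \<omega>. indicator {\<omega> \<in> space M. first_stop \<delta> n (as_of \<omega>) (xs_of \<omega>) \<and> map_hyp n (as_of \<omega>) (xs_of \<omega>) \<noteq> \<theta> \<omega>} \<omega> \<partial>M)"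
    by (intro nn_integral_indicator[symmetric] sets_Collect_first_stop_error)
  also have "\<dots> = (\<integral>\<^sup>+ \<omega>. F1 (\<theta> \<omega>) (as_of \<omega>) (xs_of \<omega>) \<partial>M)"
    by (intro nn_integral_cong) (simp add: F1_def)
  also have "\<dots> = path_integral n (\<lambda>as xs. ennreal (policy_weight n as xs) * (\<Sum>h<H. ennreal (W n as xs h) * F1 h as xs))"
    by (rule expectation_path) (rule meas(1), assumption, (rule cong(1); simp))
  also have "\<dots> \<le> path_integral n (\<lambda>as xs. ennreal \<delta> *
      (ennreal (policy_weight n as xs) * (\<Sum>h<H. ennreal (W n as xs h) * F2 h as xs)))"
  proof (rule path_integral_mono)
    fix as xs assume as: "as \<in> acts n" and xs: "xs \<in> space (P n)"
    have nn: "0 \<le> W n as xs h" if "h < H" for h using as xs that by (rule path_weight_nonneg)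
    have "(\<Sum>h<H. ennreal (W n as xs h) * F1 h as xs) \<le> ennreal \<delta> * (\<Sum>h<H. ennreal (W n as xs h) * F2 h as xs)"
    proof (cases "first_stop \<delta> n as xs")
      case True
      have "(\<Sum>h<H. ennreal (W n as xs h) * F1 h as xs) = (\<Sum>h\<in>{..<H} - {map_hyp n as xs}. ennreal (W n as xs h))"
        using True map_hyp_less[of n as xs] by (intro sum.mono_neutral_cong_right) (auto simp: F1_def)
      also have "\<dots> = ennreal (\<Sum>h\<in>{..<H} - {map_hyp n as xs}. W n as xs h)"
        using nn by (intro sum_ennreal) auto
      also have "\<dots> \<le> ennreal (\<delta> * (\<Sum>h<H. W n as xs h))"
        using stopped_error_weight[OF as xs \<delta>] True by (intro ennreal_leI) (simp add: first_stop_def)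
      also have "\<dots> = ennreal \<delta> * ennreal (\<Sum>h<H. W n as xs h)" using \<delta> by (simp add: ennreal_mult')
      also have "ennreal (\<Sum>h<H. W n as xs h) = (\<Sum>h<H. ennreal (W n as xs h))"
        using nn by (intro sum_ennreal[symmetric]) auto
      finally show ?thesis using True by (simp add: F2_def)
    qed (simp add: F1_def)
    then show "ennreal (policy_weight n as xs) * (\<Sum>h<H. ennreal (W n as xs h) * F1 h as xs) \<le>
      ennreal \<delta> * (ennreal (policy_weight n as xs) * (\<Sum>h<H. ennreal (W n as xs h) * F2 h as xs))"
      by (subst mult.left_commute) (rule mult_left_mono, auto)
  qed
  also have "\<dots> = ennreal \<delta> * path_integral n (\<lambda>as xs.
      ennreal (policy_weight n as xs) * (\<Sum>h<H. ennreal (W n as xs h) * F2 h as xs))"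
  proof (rule path_integral_cmult)
    fix as assume as: "as \<in> acts n"
    note [measurable] = meas(2)[OF as] weight_measurable_acts[OF as]
      policy_weight_measurable[of n as n, OF acts_less[OF as] order.refl]
    show "(\<lambda>xs. ennreal (policy_weight n as xs) * (\<Sum>h<H. ennreal (W n as xs h) * F2 h as xs)) \<in> borel_measurable (P n)"
      by measurable
  qed
  also have "path_integral n (\<lambda>as xs. ennreal (policy_weight n as xs) * (\<Sum>h<H. ennreal (W n as xs h) * F2 h as xs)) =
      (\<integral>\<^sup>+ \<omega>. F2 (\<theta> \<omega>) (as_of \<omega>) (xs_of \<omega>) \<partial>M)"
    by (rule expectation_path[symmetric]) (rule meas(2), assumption, (rule cong(2); simp))
  also have "\<dots> = (\<integral>\<^sup>+ \<omega>. indicator {\<omega> \<in> space M. first_stop \<delta> n (as_of \<omega>) (xs_of \<omega>)} \<omega> \<partial>M)"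
    by (intro nn_integral_cong) (simp add: F2_def)
  also have "\<dots> = emeasure M {\<omega> \<in> space M. first_stop \<delta> n (as_of \<omega>) (xs_of \<omega>)}"
    by (intro nn_integral_indicator) measurable
  finally show ?thesis .
qed

text \<open>On paths that have not stopped, \<open>weight_le_pair_affinity\<close> bounds the total
  density. The rate \<open>r\<close> is chosen before \<open>\<delta>\<close>, which is what makes
  the cost logarithmic in \<open>1 / \<delta>\<close>.\<close>

lemma not_stopped_decay:
  obtains r where "0 < r" "r < 1"
    "\<And>n \<delta>. 0 < \<delta> \<Longrightarrow> emeasure M {\<omega> \<in> space M. \<not> stop_cond H f \<delta> (as_of \<omega>) (xs_of \<omega>) n} \<le> ennreal (real H * r ^ n / \<delta>)"
proof -
  obtain r where r: "0 < r" "r < 1"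
    and decay: "\<And>n. path_integral n (\<lambda>as xs. ennreal (policy_weight n as xs) * ennreal (pair_affinity n as xs)) \<le>
       ennreal (real H * r ^ n)"
    using pair_affinity_decay by blast
  show thesis
  proof (rule that[OF r])
    fix n and \<delta> :: real assume \<delta>: "0 < \<delta>"
    define F :: "nat \<Rightarrow> _ \<Rightarrow> _ \<Rightarrow> ennreal" where
      "F h as xs = (if stop_cond H f \<delta> as xs n then 0 else 1)" for h as xs
    have meas: "F h as \<in> borel_measurable (P n)" if "as \<in> acts n" for h as
    proof -
      note [measurable] = stop_cond_measurable[of n as n \<delta>, OF acts_less[OF that] order.refl]
      show ?thesis unfolding F_def by measurable
    qed
    have cong: "F h as xs = F h as' xs'"
      if "\<And>k. k < n \<Longrightarrow> as k = as' k" "\<And>k. k < n \<Longrightarrow> xs k = xs' k" for h as as' xs xs'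
      using stop_cond_cong[OF that] by (simp add: F_def)
    have "emeasure M {\<omega> \<in> space M. \<not> stop_cond H f \<delta> (as_of \<omega>) (xs_of \<omega>) n} =
      (\<integral>\<^sup>+ \<omega>. indicator {\<omega> \<in> space M. \<not> stop_cond H f \<delta> (as_of \<omega>) (xs_of \<omega>) n} \<omega> \<partial>M)"
      by (intro nn_integral_indicator[symmetric]) measurable
    also have "\<dots> = (\<integral>\<^sup>+ \<omega>. F (\<theta> \<omega>) (as_of \<omega>) (xs_of \<omega>) \<partial>M)"
      by (intro nn_integral_cong) (simp add: F_def)
    also have "\<dots> = path_integral n (\<lambda>as xs. ennreal (policy_weight n as xs) * (\<Sum>h<H. ennreal (W n as xs h) * F h as xs))"
      by (rule expectation_path) (rule meas, assumption, (rule cong; simp))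
    also have "\<dots> \<le> path_integral n (\<lambda>as xs. ennreal (1 / \<delta>) *
        (ennreal (policy_weight n as xs) * ennreal (pair_affinity n as xs)))"
    proof (rule path_integral_mono)
      fix as xs assume as: "as \<in> acts n" and xs: "xs \<in> space (P n)"
      have nn: "0 \<le> W n as xs h" if "h < H" for h using as xs that by (rule path_weight_nonneg)
      have "(\<Sum>h<H. ennreal (W n as xs h) * F h as xs) \<le> ennreal (1 / \<delta>) * ennreal (pair_affinity n as xs)"
      proof (cases "stop_cond H f \<delta> as xs n")
        case False
        have "(\<Sum>h<H. ennreal (W n as xs h) * F h as xs) = (\<Sum>h<H. ennreal (W n as xs h))"
          using False by (simp add: F_def)
        also have "\<dots> = ennreal (\<Sum>h<H. W n as xs h)" using nn by (intro sum_ennreal) auto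
        also have "\<dots> \<le> ennreal (1 / \<delta> * pair_affinity n as xs)"
          by (intro ennreal_leI weight_le_pair_affinity as xs \<delta> False)
        also have "\<dots> = ennreal (1 / \<delta>) * ennreal (pair_affinity n as xs)" using \<delta> by (simp add: ennreal_mult'[symmetric])
        finally show ?thesis .
      qed (simp add: F_def)
      then show "ennreal (policy_weight n as xs) * (\<Sum>h<H. ennreal (W n as xs h) * F h as xs) \<le>
        ennreal (1 / \<delta>) * (ennreal (policy_weight n as xs) * ennreal (pair_affinity n as xs))"
        by (subst mult.left_commute) (rule mult_left_mono, auto)
    qed
    also have "\<dots> = ennreal (1 / \<delta>) * path_integral n (\<lambda>as xs.
        ennreal (policy_weight n as xs) * ennreal (pair_affinity n as xs))"
    proof (rule path_integral_cmult)
      fix as assume as: "as \<in> acts n"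
      note [measurable] = pair_affinity_measurable[OF as]
        policy_weight_measurable[of n as n, OF acts_less[OF as] order.refl]
      show "(\<lambda>xs. ennreal (policy_weight n as xs) * ennreal (pair_affinity n as xs)) \<in> borel_measurable (P n)"
        by measurable
    qed
    also have "\<dots> \<le> ennreal (1 / \<delta>) * ennreal (real H * r ^ n)" by (intro mult_left_mono decay) auto
    also have "\<dots> = ennreal (real H * r ^ n / \<delta>)" using \<delta> by (simp add: ennreal_mult'[symmetric])
    finally show "emeasure M {\<omega> \<in> space M. \<not> stop_cond H f \<delta> (as_of \<omega>) (xs_of \<omega>) n} \<le> ennreal (real H * r ^ n / \<delta>)" .
  qed
qed

lemma emeasure_never_stopped:
  assumes "0 < \<delta>"
  shows "emeasure M {\<omega> \<in> space M. \<forall>n. \<not> stop_cond H f \<delta> (as_of \<omega>) (xs_of \<omega>) n} = 0"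
proof -
  obtain r where r: "0 < r" "r < 1"
    and decay: "\<And>n \<delta>. 0 < \<delta> \<Longrightarrow> emeasure M {\<omega> \<in> space M. \<not> stop_cond H f \<delta> (as_of \<omega>) (xs_of \<omega>) n} \<le> ennreal (real H * r ^ n / \<delta>)"
    using not_stopped_decay by blast
  define N where "N = {\<omega> \<in> space M. \<forall>n. \<not> stop_cond H f \<delta> (as_of \<omega>) (xs_of \<omega>) n}"
  have "emeasure M N \<le> ennreal (real H * r ^ n / \<delta>)" for n
  proof -
    have "emeasure M N \<le> emeasure M {\<omega> \<in> space M. \<not> stop_cond H f \<delta> (as_of \<omega>) (xs_of \<omega>) n}"
      unfolding N_def by (intro emeasure_mono) auto
    also note decay[OF assms, of n]
    finally show ?thesis .
  qed
  moreover have "(\<lambda>n. ennreal (real H * r ^ n / \<delta>)) \<longlonglongrightarrow> ennreal (real H * 0 / \<delta>)"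
    using r assms by (intro tendsto_ennrealI tendsto_divide tendsto_mult tendsto_const LIMSEQ_power_zero) auto
  ultimately have "emeasure M N \<le> ennreal (real H * 0 / \<delta>)"
    by (intro LIMSEQ_le_const) auto
  then show ?thesis by (simp add: N_def)
qed

definition error_event where
  "error_event \<delta> = {\<omega> \<in> space M. \<not> ((\<exists>n. stop_cond H f \<delta> (as_of \<omega>) (xs_of \<omega>) n) \<and>
     argmax_post H (posterior H f (stop_time H f \<delta> (as_of \<omega>) (xs_of \<omega>)) (as_of \<omega>) (xs_of \<omega>)) = \<theta> \<omega>)}"

text \<open>Splitting at the first stopping time expresses errors after stopping through events of
  finitely many steps; both measurability and the bound rest on this.\<close>

lemma error_event_eq:
  "error_event \<delta> = {\<omega> \<in> space M. \<forall>n. \<not> stop_cond H f \<delta> (as_of \<omega>) (xs_of \<omega>) n} \<union>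
    (\<Union>n. {\<omega> \<in> space M. first_stop \<delta> n (as_of \<omega>) (xs_of \<omega>) \<and> map_hyp n (as_of \<omega>) (xs_of \<omega>) \<noteq> \<theta> \<omega>})"
proof -
  have eq: "stop_time H f \<delta> as xs = n" if "first_stop \<delta> n as xs" for n as xs
    unfolding stop_time_def using that by (intro Least_equality) (auto simp: first_stop_def intro: leI)
  have ex: "first_stop \<delta> (stop_time H f \<delta> as xs) as xs" if "\<exists>n. stop_cond H f \<delta> as xs n" for as xs
    using that LeastI_ex[OF that] not_less_Least unfolding first_stop_def stop_time_def by blast
  show ?thesis (is "_ = ?R")
  proof (rule set_eqI)
    fix \<omega>
    let ?N = "stop_time H f \<delta> (as_of \<omega>) (xs_of \<omega>)"
    show "\<omega> \<in> error_event \<delta> \<longleftrightarrow> \<omega> \<in> ?R"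
    proof (cases "\<exists>n. stop_cond H f \<delta> (as_of \<omega>) (xs_of \<omega>) n")
      case True
      have "first_stop \<delta> n (as_of \<omega>) (xs_of \<omega>) \<longleftrightarrow> n = ?N" for n
        using eq[of n "as_of \<omega>" "xs_of \<omega>"] ex[OF True] by metis
      moreover have "\<omega> \<notin> {\<omega> \<in> space M. \<forall>n. \<not> stop_cond H f \<delta> (as_of \<omega>) (xs_of \<omega>) n}"
        using True by blast
      ultimately have "\<omega> \<in> ?R \<longleftrightarrow> \<omega> \<in> space M \<and> map_hyp ?N (as_of \<omega>) (xs_of \<omega>) \<noteq> \<theta> \<omega>"
        by (simp only: Un_iff UN_iff mem_Collect_eq) simp
      moreover have "\<omega> \<in> error_event \<delta> \<longleftrightarrow> \<omega> \<in> space M \<and> map_hyp ?N (as_of \<omega>) (xs_of \<omega>) \<noteq> \<theta> \<omega>"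
        unfolding error_event_def map_hyp_def using True by blast
      ultimately show ?thesis by (simp only:)
    next
      case False
      then show ?thesis by (simp add: error_event_def first_stop_def)
    qed
  qed
qed

lemma error_event_sets: "error_event \<delta> \<in> sets M"
proof -
  have "(\<Union>n. {\<omega> \<in> space M. first_stop \<delta> n (as_of \<omega>) (xs_of \<omega>) \<and> map_hyp n (as_of \<omega>) (xs_of \<omega>) \<noteq> \<theta> \<omega>}) \<in> sets M"
    by (rule sets.countable_UN) (auto intro!: sets_Collect_first_stop_error)
  moreover have "{\<omega> \<in> space M. \<forall>n. \<not> stop_cond H f \<delta> (as_of \<omega>) (xs_of \<omega>) n} \<in> sets M"
    by measurable
  ultimately show ?thesis unfolding error_event_eq by blast
qed

lemma error_probability:
  assumes \<delta>: "0 < \<delta>" "\<delta> < 1"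
  shows "measure M (error_event \<delta>) \<le> \<delta>"
proof -
  define E where "E n = {\<omega> \<in> space M. first_stop \<delta> n (as_of \<omega>) (xs_of \<omega>) \<and> map_hyp n (as_of \<omega>) (xs_of \<omega>) \<noteq> \<theta> \<omega>}" for n
  define S where "S n = {\<omega> \<in> space M. first_stop \<delta> n (as_of \<omega>) (xs_of \<omega>)}" for n
  define N where "N = {\<omega> \<in> space M. \<forall>n. \<not> stop_cond H f \<delta> (as_of \<omega>) (xs_of \<omega>) n}"
  have [measurable]: "E n \<in> sets M" "S n \<in> sets M" "N \<in> sets M" for n
    unfolding E_def S_def N_def using sets_Collect_first_stop_error by measurable
  have disj: "disjoint_family S"
    unfolding disjoint_family_on_def
  proof (intro ballI impI)
    fix m n :: nat assume "m \<noteq> n"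
    then consider "m < n" | "n < m" by linarith
    then show "S m \<inter> S n = {}" by cases (auto simp: S_def first_stop_def)
  qed
  have "emeasure M (error_event \<delta>) \<le> emeasure M N + emeasure M (\<Union>n. E n)"
    unfolding error_event_eq E_def[symmetric] N_def[symmetric] by (intro emeasure_subadditive) auto
  also have "emeasure M N = 0" unfolding N_def using \<delta> by (intro emeasure_never_stopped)
  also have "emeasure M (\<Union>n. E n) \<le> (\<Sum>n. emeasure M (E n))"
    by (intro emeasure_subadditive_countably) auto
  also have "\<dots> \<le> (\<Sum>n. ennreal \<delta> * emeasure M (S n))"
    unfolding E_def S_def by (intro suminf_le emeasure_first_stop_error \<delta>) auto
  also have "\<dots> = ennreal \<delta> * emeasure M (\<Union>n. S n)"
    using disj by (subst suminf_emeasure[symmetric]) auto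
  also have "\<dots> \<le> ennreal \<delta> * 1" by (intro mult_left_mono emeasure_le_1) auto
  finally have "emeasure M (error_event \<delta>) \<le> ennreal \<delta>" by simp
  then show ?thesis using \<delta> by (simp add: emeasure_eq_measure)
qed

text \<open>The number of steps is at most a sum of indicators of not having stopped, so its mean is
  at most the sum of their probabilities; a step costs at most \<open>C\<close>, the sum of all
  action costs.\<close>

lemma expected_cost_upper:
  fixes c :: "nat \<Rightarrow> real"
  assumes c: "\<And>a. a < K \<Longrightarrow> 0 < c a"
  obtains \<alpha> \<beta> where "0 \<le> \<alpha>" "0 \<le> \<beta>"
    "\<And>\<delta>. 0 < \<delta> \<Longrightarrow> \<delta> < 1 \<Longrightarrow> (\<integral>\<^sup>+ \<omega>. run_cost c \<delta> \<omega> \<partial>M) \<le> ennreal (\<alpha> * ln (1 / \<delta>) + \<beta>)"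
proof -
  obtain r where r: "0 < r" "r < 1"
    and decay: "\<And>n \<delta>. 0 < \<delta> \<Longrightarrow> emeasure M {\<omega> \<in> space M. \<not> stop_cond H f \<delta> (as_of \<omega>) (xs_of \<omega>) n} \<le> ennreal (real H * r ^ n / \<delta>)"
    using not_stopped_decay by blast
  define C where "C = (\<Sum>a<K. c a)"
  have C: "c a \<le> C" if "a < K" for a
    unfolding C_def using that c by (intro member_le_sum) (auto intro: less_imp_le)
  have C0: "0 \<le> C" unfolding C_def using c by (intro sum_nonneg) (auto intro: less_imp_le)
  define t where "t = ln (1 / r)"
  have t: "0 < t" using r by (simp add: t_def)
  show thesis
  proof (rule that[of "C / t" "C * (1 + real H / (1 - r))"])
    show "0 \<le> C / t" using C0 t by simp
    show "0 \<le> C * (1 + real H / (1 - r))" using C0 r by simp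
  next
    fix \<delta> :: real assume \<delta>: "0 < \<delta>" "\<delta> < 1"
    define B where "B n = {\<omega> \<in> space M. \<not> stop_cond H f \<delta> (as_of \<omega>) (xs_of \<omega>) n}" for n
    have [measurable]: "B n \<in> sets M" for n unfolding B_def by measurable
    \<comment> \<open>From \<open>n0\<close> on, \<open>r ^ n / \<delta>\<close> is at most
      \<open>r ^ (n - n0)\<close>: a logarithmic delay pays for the factor
      \<open>1 / \<delta>\<close>. Earlier probabilities are bounded by 1.\<close>
    define n0 where "n0 = nat \<lceil>ln (1 / \<delta>) / t\<rceil>"
    have n0: "ln (1 / \<delta>) / t \<le> real n0" "real n0 \<le> ln (1 / \<delta>) / t + 1"

    proof -
      have "real n0 = of_int \<lceil>ln (1 / \<delta>) / t\<rceil>" using \<delta> t by (simp add: n0_def)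
      then show "ln (1 / \<delta>) / t \<le> real n0" "real n0 \<le> ln (1 / \<delta>) / t + 1" by linarith+
    qed
    have "r ^ n0 = exp (- (real n0 * t))"
      using r by (simp add: t_def ln_div exp_of_nat_mult)
    also have "\<dots> \<le> exp (- ln (1 / \<delta>))" using n0(1) t by (simp add: divide_le_eq)
    also have "\<dots> = \<delta>" using \<delta> by (simp add: ln_div)
    finally have rn0: "r ^ n0 \<le> \<delta>" .
    define g where "g n = (if n < n0 then 1 else real H * r ^ (n - n0))" for n
    have B_le: "emeasure M (B n) \<le> ennreal (g n)" for n
    proof (cases "n < n0")
      case True
      then show ?thesis by (simp add: g_def emeasure_le_1)
    next
      case False
      have "emeasure M (B n) \<le> ennreal (real H * r ^ n / \<delta>)" unfolding B_def using \<delta> by (intro decay)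
      also have "real H * r ^ n / \<delta> = real H * r ^ (n - n0) * (r ^ n0 / \<delta>)"
        using False by (simp add: power_add[symmetric])
      also have "\<dots> \<le> real H * r ^ (n - n0) * 1"
        using rn0 \<delta> r by (intro mult_left_mono) auto
      finally show ?thesis using False by (simp add: g_def ennreal_leI)
    qed
    have "(\<lambda>n. real H * r ^ n) sums (real H * (1 / (1 - r)))"
      using r by (intro sums_mult geometric_sums) auto
    then have "(\<lambda>n. g (n + n0)) sums (real H / (1 - r))" by (simp add: g_def)
    then have "g sums (real H / (1 - r) + (\<Sum>n<n0. g n))" by (subst (asm) sums_iff_shift)
    also have "(\<Sum>n<n0. g n) = real n0" by (simp add: g_def)
    finally have "(\<Sum>n. ennreal (g n)) = ennreal (real H / (1 - r) + real n0)"
      using r by (intro suminf_ennreal_eq) (auto simp: g_def)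
    then have sum_B: "(\<Sum>n. emeasure M (B n)) \<le> ennreal (real H / (1 - r) + real n0)"
    proof -
      have "(\<Sum>n. emeasure M (B n)) \<le> (\<Sum>n. ennreal (g n))" by (intro suminf_le B_le) auto
      with \<open>(\<Sum>n. ennreal (g n)) = _\<close> show ?thesis by simp
    qed
    \<comment> \<open>The sets \<open>B n\<close> need not decrease, but a run lies in
      \<open>B k\<close> for every \<open>k\<close> before its stopping time, so counting the
      \<open>B n\<close> that contain it bounds the number of steps.\<close>
    have "AE \<omega> in M. run_cost c \<delta> \<omega> \<le> ennreal C * (\<Sum>n. indicator (B n) \<omega>)"
    proof -
      have [measurable]: "{\<omega> \<in> space M. \<forall>n. \<not> stop_cond H f \<delta> (as_of \<omega>) (xs_of \<omega>) n} \<in> sets M" by measurable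
      have "AE \<omega> in M. \<exists>n. stop_cond H f \<delta> (as_of \<omega>) (xs_of \<omega>) n"
        by (rule AE_I[OF _ emeasure_never_stopped[OF \<delta>(1)]]) auto
      with AE_space show ?thesis
      proof eventually_elim
        case (elim \<omega>)
        define N where "N = stop_time H f \<delta> (as_of \<omega>) (xs_of \<omega>)"
        have B: "\<omega> \<in> B k" if "k < N" for k
          using elim that stop_time_le[of \<delta> "as_of \<omega>" "xs_of \<omega>" k] by (auto simp: B_def N_def)
        have "run_cost c \<delta> \<omega> = ennreal (\<Sum>k<N. c (A k \<omega>))"
          using elim by (auto simp: run_cost_def N_def)
        also have "\<dots> \<le> ennreal (\<Sum>k<N. C)"
          using elim action_less by (intro ennreal_leI sum_mono C) auto
        also have "\<dots> = ennreal C * ennreal (real N)" using C0 by (simp add: ennreal_mult'' mult.commute)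
        also have "ennreal (real N) = (\<Sum>k<N. indicator (B k) \<omega>)"
          using B by (simp add: ennreal_of_nat_eq_real_of_nat)
        also have "ennreal C * \<dots> \<le> ennreal C * (\<Sum>n. indicator (B n) \<omega>)"
          by (intro mult_left_mono sum_le_suminf) auto
        finally show ?case .
      qed
    qed
    then have "(\<integral>\<^sup>+ \<omega>. run_cost c \<delta> \<omega> \<partial>M) \<le> (\<integral>\<^sup>+ \<omega>. ennreal C * (\<Sum>n. indicator (B n) \<omega>) \<partial>M)"
      by (rule nn_integral_mono_AE)
    also have "\<dots> = ennreal C * (\<Sum>n. emeasure M (B n))"
      by (simp add: nn_integral_cmult nn_integral_suminf)
    also have "\<dots> \<le> ennreal C * ennreal (real H / (1 - r) + real n0)"
      by (intro mult_left_mono sum_B) auto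
    also have "\<dots> = ennreal (C * (real H / (1 - r) + real n0))"
      using C0 r by (subst ennreal_mult) auto
    also have "\<dots> \<le> ennreal (C * (real H / (1 - r) + (ln (1 / \<delta>) / t + 1)))"
      using n0 C0 by (intro ennreal_leI mult_left_mono) auto
    also have "C * (real H / (1 - r) + (ln (1 / \<delta>) / t + 1)) = C / t * ln (1 / \<delta>) + C * (1 + real H / (1 - r))"
      by (simp add: algebra_simps)
    finally show "(\<integral>\<^sup>+ \<omega>. run_cost c \<delta> \<omega> \<partial>M) \<le> ennreal (C / t * ln (1 / \<delta>) + C * (1 + real H / (1 - r)))" .
  qed
qed

end

subsection \<open>Lower bound on the cost\<close>

text \<open>Where a density vanishes, the logarithm of the quotient is a mere convention. The
  support condition excludes this almost everywhere under each sampling density.\<close>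

locale regular_run = bounded_run +
  assumes support: "a < K \<Longrightarrow> i < H \<Longrightarrow> j < H \<Longrightarrow> AE x in \<mu>. 0 < f i a x \<longrightarrow> 0 < f j a x"
    and second_moment: "a < K \<Longrightarrow> i < H \<Longrightarrow> j < H \<Longrightarrow>
      integrable \<mu> (\<lambda>x. f i a x * (log 2 (f i a x / f j a x))\<^sup>2)"
    and two_hyps: "2 \<le> H"
begin

lemma AE_all_support:
  assumes "a < K" "h < H"
  shows "AE x in \<mu>. 0 < f h a x \<longrightarrow> (\<forall>j<H. 0 < f j a x)"
proof -
  have "AE x in \<mu>. \<forall>j\<in>{..<H}. 0 < f h a x \<longrightarrow> 0 < f j a x"
    using assms by (intro AE_finite_allI support) auto
  then show ?thesis by eventually_elim auto
qed

text \<open>The bound for one observation is applied to the indicator \<open>G a\<close> of the set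
  where some likelihood vanishes: under every \<open>f h a\<close> this set has measure 0.\<close>

lemma AE_likelihoods_pos: "AE \<omega> in M. \<forall>k. \<forall>j<H. 0 < f j (A k \<omega>) (X k \<omega>)"
proof -
  define G :: "nat \<Rightarrow> _ \<Rightarrow> real" where "G a x = (if \<forall>j\<in>{..<H}. 0 < f j a x then 0 else 1)" for a x
  have meas: "G a \<in> borel_measurable \<mu>" if "a < K" for a
  proof -
    have [measurable]: "f h a \<in> borel_measurable \<mu>" if "h < H" for h using that \<open>a < K\<close> by simp
    have [measurable]: "Measurable.pred \<mu> (\<lambda>x. \<forall>j\<in>{..<H}. 0 < f j a x)"
      by (intro pred_intros_finite) auto
    show ?thesis unfolding G_def by measurable
  qed
  have "AE \<omega> in M. G (A k \<omega>) (X k \<omega>) = 0" for k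
  proof -
    have "(\<integral>\<^sup>+ \<omega>. ennreal (G (A k \<omega>) (X k \<omega>)) \<partial>M) \<le> (\<Sum>h<H. \<Sum>a<K. \<integral>\<^sup>+ x. ennreal (f h a x) * ennreal (G a x) \<partial>\<mu>)"
      using meas by (intro expectation_last_le[where G = "\<lambda>a x. ennreal (G a x)"]) auto
    also have "\<dots> = 0"
    proof (intro sum.neutral ballI)
      fix h a assume "h \<in> {..<H}" "a \<in> {..<K}"
      then have ha: "h < H" "a < K" by auto
      have "AE x in \<mu>. ennreal (f h a x) * ennreal (G a x) = 0"
        using AE_all_support[OF ha(2,1)]
      proof eventually_elim
        case (elim x)
        show ?case
        proof (cases "0 < f h a x")
          case True
          with elim have "G a x = 0" by (simp add: G_def)
          then show ?thesis by simp
        qed (simp add: ennreal_neg)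
      qed
      then have "(\<integral>\<^sup>+ x. ennreal (f h a x) * ennreal (G a x) \<partial>\<mu>) = (\<integral>\<^sup>+ x. 0 \<partial>\<mu>)"
        by (rule nn_integral_cong_AE)
      then show "(\<integral>\<^sup>+ x. ennreal (f h a x) * ennreal (G a x) \<partial>\<mu>) = 0" by simp
    qed
    finally have "(\<integral>\<^sup>+ \<omega>. ennreal (G (A k \<omega>) (X k \<omega>)) \<partial>M) = 0" by simp
    then have "AE \<omega> in M. ennreal (G (A k \<omega>) (X k \<omega>)) = 0"
      using action_sample_measurable[of G k, OF meas] by (subst (asm) nn_integral_0_iff_AE) auto
    then show ?thesis by eventually_elim (simp add: G_def split: if_splits)
  qed
  then have "AE \<omega> in M. \<forall>k. G (A k \<omega>) (X k \<omega>) = 0" by (simp add: AE_all_countable)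
  then show ?thesis by eventually_elim (auto simp: G_def split: if_splits)
qed

text \<open>The moment assumption concerns ratios with the sampling density in the numerator. A
  general pair is routed through \<open>h\<close>, as a difference of two such log-ratios, and
  \<open>\<bar>y\<bar> \<le> 1 + y^2\<close> turns second moments into a bound.\<close>

lemma abs_llr_integral_finite:
  assumes h: "h < H" and a: "a < K"
  shows "(\<integral>\<^sup>+ x. ennreal (f h a x) * ennreal (abs_llr a x) \<partial>\<mu>) < \<infinity>"
proof -
  define q where "q i x = f h a x + f h a x * (log 2 (f h a x / f i a x))\<^sup>2" for i x
  have q_int: "integrable \<mu> (q i)" if "i < H" for i
    unfolding q_def using that h a dens_nonneg dens_one
    by (intro Bochner_Integration.integrable_add second_moment density_integrable) auto
  have le: "AE x in \<mu>. ennreal (f h a x) * ennreal (abs_llr a x) \<le> ennreal (\<Sum>i<H. \<Sum>j<H. q i x + q j x)"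
    using AE_all_support[OF a h] AE_space
  proof eventually_elim
    case (elim x)
    have nn: "0 \<le> f h a x" using elim h a dens_nonneg by auto
    have "f h a x * \<bar>log 2 (f i a x / f j a x)\<bar> \<le> q i x + q j x" if "i < H" "j < H" for i j
    proof (cases "0 < f h a x")
      case True
      with elim that have p: "0 < f i a x" "0 < f j a x" by auto
      have eq: "log 2 (f i a x / f j a x) = log 2 (f h a x / f j a x) - log 2 (f h a x / f i a x)"
        using p True by (simp add: log_divide_pos)
      have sq: "\<bar>y\<bar> \<le> 1 + y\<^sup>2" for y :: real
        using zero_le_power2[of "\<bar>y\<bar> - 1"] by (simp add: power2_diff)
      have "\<bar>log 2 (f i a x / f j a x)\<bar> \<le> (1 + (log 2 (f h a x / f i a x))\<^sup>2) + (1 + (log 2 (f h a x / f j a x))\<^sup>2)"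
        unfolding eq using sq[of "log 2 (f h a x / f i a x)"] sq[of "log 2 (f h a x / f j a x)"] by linarith
      from mult_left_mono[OF this nn] show ?thesis by (simp add: q_def algebra_simps)
    next
      case False
      with nn have "f h a x = 0" by simp
      then show ?thesis by (simp add: q_def)
    qed
    then have "f h a x * abs_llr a x \<le> (\<Sum>i<H. \<Sum>j<H. q i x + q j x)"
      unfolding abs_llr_def sum_distrib_left by (intro sum_mono) auto
    with nn show ?case by (simp add: ennreal_mult'[symmetric] ennreal_leI)
  qed
  have int: "integrable \<mu> (\<lambda>x. \<Sum>i<H. \<Sum>j<H. q i x + q j x)"
    using q_int by (intro Bochner_Integration.integrable_sum Bochner_Integration.integrable_add) auto
  have "(\<integral>\<^sup>+ x. ennreal (f h a x) * ennreal (abs_llr a x) \<partial>\<mu>) \<le> (\<integral>\<^sup>+ x. ennreal (\<Sum>i<H. \<Sum>j<H. q i x + q j x) \<partial>\<mu>)"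
    by (rule nn_integral_mono_AE[OF le])
  also have "\<dots> = ennreal (\<integral>x. (\<Sum>i<H. \<Sum>j<H. q i x + q j x) \<partial>\<mu>)"
    using h a dens_nonneg by (intro nn_integral_eq_integral int AE_I2 sum_nonneg) (auto simp: q_def)
  also have "\<dots> < \<infinity>" by simp
  finally show ?thesis .
qed

lemma expected_abs_llr:
  obtains C where "0 < C" "\<And>k. (\<integral>\<^sup>+ \<omega>. ennreal (abs_llr (A k \<omega>) (X k \<omega>)) \<partial>M) \<le> ennreal C"
proof -
  define T where "T = (\<Sum>h<H. \<Sum>a<K. \<integral>\<^sup>+ x. ennreal (f h a x) * ennreal (abs_llr a x) \<partial>\<mu>)"
  have "T < \<infinity>" unfolding T_def using abs_llr_integral_finite by (simp add: ennreal_sum_less_top)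
  then obtain C where C: "0 \<le> C" "T = ennreal C" by (cases T) auto
  show thesis
  \<comment> \<open>The mean bound may be 0; adding 1 gives a positive constant, by which the lower
    bound divides.\<close>
  proof (rule that[of "C + 1"])
    show "(\<integral>\<^sup>+ \<omega>. ennreal (abs_llr (A k \<omega>) (X k \<omega>)) \<partial>M) \<le> ennreal (C + 1)" for k
    proof -
      have "(\<integral>\<^sup>+ \<omega>. ennreal (abs_llr (A k \<omega>) (X k \<omega>)) \<partial>M) \<le> T"
        unfolding T_def using abs_llr_measurable
        by (intro expectation_last_le[where G = "\<lambda>a x. ennreal (abs_llr a x)"]) auto
      also have "\<dots> \<le> ennreal (C + 1)" using C by (simp add: ennreal_leI)
      finally show ?thesis .
    qed
  qed (use C in simp)
qed

text \<open>Markov's inequality is applied to the nonnegative sum up to a fixed time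
  \<open>n\<close>, which avoids sums up to a random time.\<close>

lemma expected_cost_lower:
  fixes c :: "nat \<Rightarrow> real"
  assumes c: "\<And>a. a < K \<Longrightarrow> 0 < c a"
  obtains \<alpha> \<beta> where "0 < \<alpha>"
    "\<And>\<delta>. 0 < \<delta> \<Longrightarrow> \<delta> < 1 / 2 \<Longrightarrow> ennreal (\<alpha> * log 2 ((1 - \<delta>) / \<delta>) - \<beta>) \<le> (\<integral>\<^sup>+ \<omega>. run_cost c \<delta> \<omega> \<partial>M)"
proof -
  obtain C where C: "0 < C" and EC: "\<And>k. (\<integral>\<^sup>+ \<omega>. ennreal (abs_llr (A k \<omega>) (X k \<omega>)) \<partial>M) \<le> ennreal C"
    using expected_abs_llr by blast
  have K0: "0 < K" using lam_sum[OF H_pos] by (cases "K = 0") auto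
  define c0 where "c0 = Min (c ` {..<K})"
  have c0: "0 < c0" "\<And>a. a < K \<Longrightarrow> c0 \<le> c a" 
  proof -
    have "c ` {..<K} \<noteq> {}" using K0 by auto
    with c show "0 < c0" by (simp add: c0_def)
    show "c0 \<le> c a" if "a < K" for a unfolding c0_def using that by (intro Min_le) auto
  qed
  show thesis
  proof (rule that[of "c0 / (4 * C)" "c0 / 2"])
    show "0 < c0 / (4 * C)" using c0 C by simp
  next
    fix \<delta> :: real assume \<delta>: "0 < \<delta>" "\<delta> < 1 / 2"
    define L where "L = log 2 ((1 - \<delta>) / \<delta>)"
    have L: "0 < L" unfolding L_def using \<delta> by (subst zero_less_log_cancel_iff) (auto simp: field_simps)
    \<comment> \<open>The probability of stopping before \<open>n\<close> is at most
      \<open>n * C / L\<close>, here at most \<open>1 / 2\<close>. Rounding down loses at most one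
      step, whence the subtracted \<open>c0 / 2\<close> in the result.\<close>
    define n where "n = nat \<lfloor>L / (2 * C)\<rfloor>"
    have n: "real n \<le> L / (2 * C)" "L / (2 * C) - 1 \<le> real n"

    proof -
      have "real n = of_int \<lfloor>L / (2 * C)\<rfloor>" using L C by (simp add: n_def)
      then show "real n \<le> L / (2 * C)" "L / (2 * C) - 1 \<le> real n" by linarith+
    qed
    define Y where "Y \<omega> = (\<Sum>k<n. abs_llr (A k \<omega>) (X k \<omega>))" for \<omega>
    have [measurable]: "(\<lambda>\<omega>. abs_llr (A k \<omega>) (X k \<omega>)) \<in> borel_measurable M" for k
      by (intro action_sample_measurable abs_llr_measurable)
    have Y [measurable]: "Y \<in> borel_measurable M" unfolding Y_def by measurable
    have Y0: "0 \<le> Y \<omega>" for \<omega> unfolding Y_def by (intro sum_nonneg abs_llr_nonneg)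
    define D where "D = {\<omega> \<in> space M. \<exists>m<n. stop_cond H f \<delta> (as_of \<omega>) (xs_of \<omega>) m}"
    have D [measurable]: "D \<in> sets M" unfolding D_def by measurable
    have "AE \<omega> in M. \<omega> \<in> D \<longrightarrow> \<omega> \<in> {\<omega> \<in> space M. 1 \<le> ennreal (1 / L) * ennreal (Y \<omega>)}"
      using AE_likelihoods_pos AE_space
    proof eventually_elim
      case (elim \<omega>)
      show ?case
      proof
        assume "\<omega> \<in> D"
        then obtain m where m: "m < n" "stop_cond H f \<delta> (as_of \<omega>) (xs_of \<omega>) m" by (auto simp: D_def)
        have "L \<le> Y \<omega>" unfolding L_def Y_def
          using elim \<delta> two_hyps by (intro stop_cond_imp_abs_llr[OF _ m]) auto
        then have "ennreal 1 \<le> ennreal (1 / L * Y \<omega>)" using L by (intro ennreal_leI) simp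
        also have "\<dots> = ennreal (1 / L) * ennreal (Y \<omega>)" using L Y0 by (intro ennreal_mult) auto
        finally show "\<omega> \<in> {\<omega> \<in> space M. 1 \<le> ennreal (1 / L) * ennreal (Y \<omega>)}" using elim by simp
      qed
    qed
    then have "emeasure M D \<le> emeasure M {\<omega> \<in> space M. 1 \<le> ennreal (1 / L) * ennreal (Y \<omega>)}"
      by (intro emeasure_mono_AE) measurable
    also have "\<dots> \<le> ennreal (1 / L) * (\<integral>\<^sup>+ \<omega>. ennreal (Y \<omega>) * indicator (space M) \<omega> \<partial>M)"
      by (intro nn_integral_Markov_inequality) measurable
    also have "(\<integral>\<^sup>+ \<omega>. ennreal (Y \<omega>) * indicator (space M) \<omega> \<partial>M) = (\<integral>\<^sup>+ \<omega>. (\<Sum>k<n. ennreal (abs_llr (A k \<omega>) (X k \<omega>))) \<partial>M)"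
      by (intro nn_integral_cong) (simp add: Y_def abs_llr_nonneg sum_ennreal)
    also have "\<dots> = (\<Sum>k<n. \<integral>\<^sup>+ \<omega>. ennreal (abs_llr (A k \<omega>) (X k \<omega>)) \<partial>M)"
      by (intro nn_integral_sum) measurable
    also have "ennreal (1 / L) * \<dots> \<le> ennreal (1 / L) * (\<Sum>k<n. ennreal C)"
      by (intro mult_left_mono sum_mono EC) auto
    also have "\<dots> = ennreal (1 / L * (real n * C))"
      using C L by (subst sum_ennreal) (auto simp: ennreal_mult'[symmetric])
    also have "\<dots> \<le> ennreal (1 / 2)" using n(1) C L by (intro ennreal_leI) (simp add: field_simps)
    finally have "emeasure M D \<le> ennreal (1 / 2)" .
    then have "ennreal (measure M D) \<le> ennreal (1 / 2)" by (simp only: emeasure_eq_measure)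
    then have "measure M D \<le> 1 / 2" by (subst (asm) ennreal_le_iff) simp_all
    then have half: "1 / 2 \<le> measure M (space M - D)" by (simp add: prob_compl)
    \<comment> \<open>A run that never stops has infinite cost; a run outside \<open>D\<close> that
      does stop takes at least \<open>n\<close> steps.\<close>
    have le: "ennreal (c0 * real n) * indicator (space M - D) \<omega> \<le> run_cost c \<delta> \<omega>" if "\<omega> \<in> space M" for \<omega>
    proof (cases "\<omega> \<in> D \<or> \<not> (\<exists>n. stop_cond H f \<delta> (as_of \<omega>) (xs_of \<omega>) n)")
      case True
      then show ?thesis by (auto simp: run_cost_def)
    next
      case False
      define N where "N = stop_time H f \<delta> (as_of \<omega>) (xs_of \<omega>)"
      from False have "stop_cond H f \<delta> (as_of \<omega>) (xs_of \<omega>) N"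
        unfolding N_def using stop_time_stops by blast
      with False that have "\<not> N < n" by (auto simp: D_def)
      then have "c0 * real n \<le> (\<Sum>k<N. c0)" using c0 by simp
      also have "\<dots> \<le> (\<Sum>k<N. c (A k \<omega>))" using action_less[OF that] c0 by (intro sum_mono) auto
      finally show ?thesis using False by (simp add: run_cost_def N_def ennreal_leI indicator_def)
    qed
    have "c0 / (4 * C) * L - c0 / 2 \<le> c0 * real n * (1 / 2)"
      using mult_left_mono[OF n(2), of "c0 / 2"] c0 by (simp add: algebra_simps)
    also have "\<dots> \<le> c0 * real n * measure M (space M - D)" using half c0 by (intro mult_left_mono) auto
    finally have "ennreal (c0 / (4 * C) * L - c0 / 2) \<le> ennreal (c0 * real n * measure M (space M - D))"
      by (rule ennreal_leI)
    also have "\<dots> = (\<integral>\<^sup>+ \<omega>. ennreal (c0 * real n) * indicator (space M - D) \<omega> \<partial>M)"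
      using c0 by (simp add: nn_integral_cmult emeasure_eq_measure ennreal_mult')
    also have "\<dots> \<le> (\<integral>\<^sup>+ \<omega>. run_cost c \<delta> \<omega> \<partial>M)" using le by (intro nn_integral_mono)
    finally show "ennreal (c0 / (4 * C) * log 2 ((1 - \<delta>) / \<delta>) - c0 / 2) \<le> (\<integral>\<^sup>+ \<omega>. run_cost c \<delta> \<omega> \<partial>M)"
      by (simp add: L_def)
  qed
qed

end

subsection \<open>Optimal action distributions and asymptotics\<close>

text \<open>A density has affinity 1 with itself, which contradicts the strict bound that a nonzero
  divergence would give.\<close>

lemma KLD_self:
  assumes p: "p \<in> borel_measurable \<mu>" "\<forall>x\<in>space \<mu>. 0 \<le> p x" "(\<integral>\<^sup>+ x. ennreal (p x) \<partial>\<mu>) = 1"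
  shows "KLD \<mu> p p = 0"
proof (rule ccontr)
  assume "KLD \<mu> p p \<noteq> 0"
  then have "affinity \<mu> p p < 1" by (rule affinity_less_1[OF p p])
  moreover have "affinity \<mu> p p = (\<integral>x. p x \<partial>\<mu>)"
    unfolding affinity_def using p(2) by (intro Bochner_Integration.integral_cong) auto
  ultimately show False using density_integral[OF p] by simp
qed

text \<open>The optimal value is at least that of the uniform distribution, hence positive. So the
  minimum over \<open>j\<close> is positive at \<open>l\<close>, and for each \<open>j\<close> some
  summand is nonzero, which takes an action of positive probability.\<close>

lemma optimal_action_informative:
  assumes H: "2 \<le> H" and K: "0 < K" and c: "\<And>a. a < K \<Longrightarrow> 0 < c a"
    and nonneg: "\<And>a i j. a < K \<Longrightarrow> i < H \<Longrightarrow> j < H \<Longrightarrow> 0 \<le> KLD \<mu> (f i a) (f j a)"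
    and pos: "\<And>i j. i < H \<Longrightarrow> j < H \<Longrightarrow> i \<noteq> j \<Longrightarrow> \<exists>a<K. 0 < KLD \<mu> (f i a) (f j a)"
    and l: "l \<in> act_simplex K"
    and opt: "\<And>l'. l' \<in> act_simplex K \<Longrightarrow> objective \<mu> H K f c h l' \<le> objective \<mu> H K f c h l"
    and hj: "h < H" "j < H" "j \<noteq> h"
  shows "\<exists>a<K. 0 < l a \<and> KLD \<mu> (f h a) (f j a) \<noteq> 0"
proof -
  define S where "S l = {(\<Sum>a<K. l a * KLD \<mu> (f h a) (f j a)) | j. j < H \<and> j \<noteq> h}" for l :: "nat \<Rightarrow> real"
  have S: "finite (S l)" "S l \<noteq> {}" for l using hj by (auto simp: S_def)
  \<comment> \<open>All actions get positive probability, so every mean divergence under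
    \<open>u\<close> contains a positive term by \<open>pos\<close>.\<close>
  define u where "u = (\<lambda>_::nat. 1 / real K)"
  have u: "u \<in> act_simplex K" using K by (auto simp: u_def act_simplex_def)
  have "0 < Min (S u)"
  proof (subst Min_gr_iff[OF S], safe)
    fix s assume "s \<in> S u"
    then obtain i where i: "i < H" "i \<noteq> h" "s = (\<Sum>a<K. u a * KLD \<mu> (f h a) (f i a))"
      by (auto simp: S_def)
    obtain b where b: "b < K" "0 < KLD \<mu> (f h b) (f i b)" using pos[OF hj(1) i(1)] i by auto
    have nn: "0 \<le> KLD \<mu> (f h a) (f i a)" if "a < K" for a using nonneg that hj i by auto
    have "0 < (\<Sum>a<K. u a * KLD \<mu> (f h a) (f i a))"
      using b K nn by (intro sum_pos2[of _ b]) (auto simp: u_def)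
    then show "0 < s" using i by simp
  qed
  moreover have "0 < (\<Sum>a<K. u a * c a)" using K c by (intro sum_pos) (auto simp: u_def)
  ultimately have "0 < objective \<mu> H K f c h u" unfolding objective_def S_def by (rule divide_pos_pos)
  with opt[OF u] have "0 < Min (S l) / (\<Sum>a<K. l a * c a)" unfolding objective_def S_def by linarith
  \<comment> \<open>A positive quotient with nonnegative denominator has a positive numerator; a
    zero denominator would make the quotient 0 by convention.\<close>
  moreover have "0 \<le> (\<Sum>a<K. l a * c a)"
    using l c by (intro sum_nonneg mult_nonneg_nonneg) (auto simp: act_simplex_def less_imp_le)
  ultimately have "0 < Min (S l)" by (auto simp: zero_less_divide_iff)
  moreover have "(\<Sum>a<K. l a * KLD \<mu> (f h a) (f j a)) \<in> S l" using hj by (auto simp: S_def)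
  ultimately have "(\<Sum>a<K. l a * KLD \<mu> (f h a) (f j a)) \<noteq> 0" using Min_gr_iff[OF S] by fastforce
  then obtain a where "a < K" "l a * KLD \<mu> (f h a) (f j a) \<noteq> 0"
    by (meson lessThan_iff sum.neutral)
  moreover from this l have "0 \<le> l a" by (auto simp: act_simplex_def)
  ultimately show ?thesis by (intro exI[of _ a]) auto
qed

lemma bigtheta_log_inverse:
  fixes e :: "real \<Rightarrow> real"
  assumes upper: "\<And>\<delta>. 0 < \<delta> \<Longrightarrow> \<delta> < 1 \<Longrightarrow> e \<delta> \<le> \<alpha> * ln (1 / \<delta>) + \<beta>" and \<alpha>: "0 \<le> \<alpha>" and \<beta>: "0 \<le> \<beta>"
    and lower: "\<And>\<delta>. 0 < \<delta> \<Longrightarrow> \<delta> < 1 / 2 \<Longrightarrow> \<alpha>' * log 2 ((1 - \<delta>) / \<delta>) - \<beta>' \<le> e \<delta>" and \<alpha>': "0 < \<alpha>'"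
    and nonneg: "\<And>\<delta>. 0 \<le> e \<delta>"
  shows "e \<in> \<Theta>[at_right 0](\<lambda>\<delta>. ln (1 / \<delta>))"
proof (rule bigthetaI)
  \<comment> \<open>With \<open>L = ln (1 / \<delta>)\<close>, the entry 1 lets \<open>L\<close>
    absorb \<open>\<beta>\<close>. The other entry makes \<open>\<alpha>' + \<beta>'\<close> at most
    half of the leading term \<open>\<alpha>' / ln 2 * L\<close>, which leaves the coefficient
    \<open>\<alpha>' / (2 * ln 2)\<close>.\<close>
  define B where "B = max 1 (2 * ln 2 / \<alpha>' * (\<alpha>' + \<beta>'))"
  have ev: "\<forall>\<^sub>F \<delta> in at_right 0. 0 < \<delta> \<and> \<delta> < 1 / 2 \<and> B \<le> ln (1 / \<delta>)"
    unfolding eventually_at_right_field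
  proof (intro exI[of _ "min (1 / 2) (exp (- B))"] conjI allI impI)
    fix \<delta> :: real assume *: "0 < \<delta>" "\<delta> < min (1 / 2) (exp (- B))"
    then have "ln \<delta> < ln (exp (- B))" by (subst ln_less_cancel_iff) auto
    with * show "0 < \<delta>" "\<delta> < 1 / 2" "B \<le> ln (1 / \<delta>)" by (auto simp: ln_div)
  qed auto
  have "\<forall>\<^sub>F \<delta> in at_right 0. norm (e \<delta>) \<le> (\<alpha> + \<beta>) * norm (ln (1 / \<delta>))"
    using ev
  proof eventually_elim
    case (elim \<delta>)
    then have L: "1 \<le> ln (1 / \<delta>)" by (simp add: B_def)
    have "e \<delta> \<le> \<alpha> * ln (1 / \<delta>) + \<beta>" using elim by (intro upper) auto
    also have "\<dots> \<le> (\<alpha> + \<beta>) * ln (1 / \<delta>)" using mult_left_mono[OF L \<beta>] by (simp add: algebra_simps)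
    finally show ?case using L nonneg[of \<delta>] by simp
  qed
  then show "e \<in> O[at_right 0](\<lambda>\<delta>. ln (1 / \<delta>))" by (rule bigoI)
  have "\<forall>\<^sub>F \<delta> in at_right 0. \<alpha>' / (2 * ln 2) * norm (ln (1 / \<delta>)) \<le> norm (e \<delta>)"
    using ev
  proof eventually_elim
    case (elim \<delta>)
    then have L: "1 \<le> ln (1 / \<delta>)" "2 * ln 2 / \<alpha>' * (\<alpha>' + \<beta>') \<le> ln (1 / \<delta>)" by (auto simp: B_def)
    \<comment> \<open>For \<open>\<delta> < 1 / 2\<close> the factor \<open>1 - \<delta>\<close>
      costs at most \<open>ln 2\<close>, so the threshold is \<open>ln (1 / \<delta>) / ln 2\<close>
      up to an additive 1.\<close>
    have "ln (1 / 2 :: real) \<le> ln (1 - \<delta>)" using elim by (subst ln_le_cancel_iff) auto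
    then have "(ln (1 / \<delta>) - ln 2) / ln 2 \<le> log 2 ((1 - \<delta>) / \<delta>)"
      using elim by (auto simp: log_def ln_div intro!: divide_right_mono)
    then have "\<alpha>' * ((ln (1 / \<delta>) - ln 2) / ln 2) - \<beta>' \<le> e \<delta>"
      using lower[of \<delta>] elim mult_left_mono[of "(ln (1 / \<delta>) - ln 2) / ln 2" "log 2 ((1 - \<delta>) / \<delta>)" \<alpha>'] \<alpha>' by simp
    moreover have "\<alpha>' + \<beta>' \<le> \<alpha>' / (2 * ln 2) * ln (1 / \<delta>)"
      using L(2) \<alpha>' by (simp add: field_simps)
    moreover have "\<alpha>' * ((ln (1 / \<delta>) - ln 2) / ln 2) = 2 * (\<alpha>' / (2 * ln 2) * ln (1 / \<delta>)) - \<alpha>'"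
      by (simp add: field_simps)
    ultimately show ?case using L(1) nonneg[of \<delta>] by simp
  qed
  then show "e \<in> \<Omega>[at_right 0](\<lambda>\<delta>. ln (1 / \<delta>))"
    using \<alpha>' by (intro landau_omega.bigI[of "\<alpha>' / (2 * ln 2)"]) auto
qed

text \<open>\<open>enn2real\<close> sends infinity to 0, so the clause on finiteness makes the last
  clause speak of the true expectation. The change from base 2 to \<open>ln\<close> is a constant
  factor, absorbed by \<open>\<Theta>\<close>.\<close>

theorem theorem1:
  fixes \<mu> :: "'x measure"
    and H K :: nat
    and f :: "nat \<Rightarrow> nat \<Rightarrow> 'x \<Rightarrow> real"
    and c :: "nat \<Rightarrow> real"
    and lam :: "nat \<Rightarrow> nat \<Rightarrow> real"
    and M :: "'w measure"
    and \<theta> :: "'w \<Rightarrow> nat"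
    and A :: "nat \<Rightarrow> 'w \<Rightarrow> nat"
    and X :: "nat \<Rightarrow> 'w \<Rightarrow> 'x"
  assumes H_pos: "0 < H" and K_pos: "0 < K"
    and cost_pos: "\<forall>a<K. 0 < c a"
    and mu: "sigma_finite_measure \<mu>"
    and dens_meas: "\<forall>h<H. \<forall>a<K. f h a \<in> borel_measurable \<mu>"
    and dens_nonneg: "\<forall>h<H. \<forall>a<K. \<forall>x\<in>space \<mu>. 0 \<le> f h a x"
    and dens_one: "\<forall>h<H. \<forall>a<K. (\<integral>\<^sup>+ x. ennreal (f h a x) \<partial>\<mu>) = 1"
    and A1: "\<forall>a<K. \<forall>i<H. \<forall>j<H. KLD \<mu> (f i a) (f j a) = 0 \<or> KLD \<mu> (f i a) (f j a) > 0"
    and A2a: "\<forall>i<H. \<forall>j<H. i \<noteq> j \<longrightarrow> (\<exists>a<K. KLD \<mu> (f i a) (f j a) > 0)"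
    and A2b: "\<not> (\<exists>a<K. \<forall>i<H. \<forall>j<H. KLD \<mu> (f i a) (f j a) = 0)"
    and A3: "\<exists>\<beta>>0. \<forall>a<K. \<forall>i<H. \<forall>j<H.
               (AE x in \<mu>. 0 < f i a x \<longrightarrow> 0 < f j a x) \<and>
               integrable \<mu> (\<lambda>x. f i a x * (log 2 (f i a x / f j a x))\<^sup>2) \<and>
               (\<integral>x. f i a x * (log 2 (f i a x / f j a x))\<^sup>2 \<partial>\<mu>) < \<beta>"
    and lam_opt: "\<forall>h<H. lam h \<in> act_simplex K \<and>
                    (\<forall>l\<in>act_simplex K. objective \<mu> H K f c h l \<le> objective \<mu> H K f c h (lam h))"
    and M: "prob_space M"
    and \<theta>_meas: "\<theta> \<in> measurable M (count_space UNIV)"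
    and A_meas: "\<forall>k. A k \<in> measurable M (count_space UNIV)"
    and X_meas: "\<forall>k. X k \<in> measurable M \<mu>"
    and law: "\<forall>n h as Bs. h < H \<longrightarrow> (\<forall>k<n. as k < K) \<longrightarrow> (\<forall>k<n. Bs k \<in> sets \<mu>) \<longrightarrow>
               emeasure M {\<omega> \<in> space M. \<theta> \<omega> = h \<and> (\<forall>k<n. A k \<omega> = as k \<and> X k \<omega> \<in> Bs k)} =
               (\<integral>\<^sup>+ xs. ennreal ((1 / real H) *
                   (\<Prod>k<n. indicator (Bs k) (xs k) *
                      lam (argmax_post H (posterior H f k as xs)) (as k) * f h (as k) (xs k)))
                 \<partial>(\<Pi>\<^sub>M k\<in>{..<n}. \<mu>))"
  shows
    "(\<forall>\<delta>. 0 < \<delta> \<and> \<delta> < 1 \<longrightarrow>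
        measure M {\<omega> \<in> space M.
           \<not> ((\<exists>n. stop_cond H f \<delta> (\<lambda>k. A k \<omega>) (\<lambda>k. X k \<omega>) n) \<and>
              argmax_post H (posterior H f (stop_time H f \<delta> (\<lambda>k. A k \<omega>) (\<lambda>k. X k \<omega>))
                   (\<lambda>k. A k \<omega>) (\<lambda>k. X k \<omega>)) = \<theta> \<omega>)} \<le> \<delta>)
     \<and> (\<forall>\<^sub>F \<delta> in at_right 0.
          (\<integral>\<^sup>+ \<omega>. (if \<exists>n. stop_cond H f \<delta> (\<lambda>k. A k \<omega>) (\<lambda>k. X k \<omega>) n
                    then ennreal (\<Sum>k < stop_time H f \<delta> (\<lambda>k. A k \<omega>) (\<lambda>k. X k \<omega>). c (A k \<omega>))
                    else \<infinity>) \<partial>M) < \<infinity>)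
     \<and> (\<lambda>\<delta>. enn2real (\<integral>\<^sup>+ \<omega>. (if \<exists>n. stop_cond H f \<delta> (\<lambda>k. A k \<omega>) (\<lambda>k. X k \<omega>) n
                    then ennreal (\<Sum>k < stop_time H f \<delta> (\<lambda>k. A k \<omega>) (\<lambda>k. X k \<omega>). c (A k \<omega>))
                    else \<infinity>) \<partial>M))
         \<in> \<Theta>[at_right 0](\<lambda>\<delta>. ln (1 / \<delta>))"
proof -
  \<comment> \<open>With one hypothesis the only divergence is that of a density from itself, which
    is 0; every action would be uninformative, against A2.\<close>
  have two: "2 \<le> H"
  proof (rule ccontr)
    assume "\<not> 2 \<le> H"
    with H_pos have "H = 1" by simp
    moreover have "KLD \<mu> (f 0 0) (f 0 0) = 0"
      using H_pos K_pos dens_meas dens_nonneg dens_one by (intro KLD_self) auto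
    ultimately show False using A2b K_pos by (auto simp: less_one)
  qed
  have KLD_nonneg: "0 \<le> KLD \<mu> (f i a) (f j a)" if "a < K" "i < H" "j < H" for a i j
  proof -
    have "KLD \<mu> (f i a) (f j a) = 0 \<or> 0 < KLD \<mu> (f i a) (f j a)" using A1 that by blast
    then show ?thesis by linarith
  qed
  interpret map_policy \<mu> H K f lam
    using H_pos mu dens_meas dens_nonneg dens_one lam_opt
    by (intro map_policy.intro map_policy_axioms.intro) (auto simp: act_simplex_def)
  interpret informative_policy \<mu> H K f lam
  proof
    fix h j assume hj: "h < H" "j < H" "j \<noteq> h"
    show "mixed_affinity h h j < 1"
      using hj lam_opt KLD_nonneg A2a cost_pos
      by (intro mixed_affinity_less_1 optimal_action_informative[OF two K_pos, of c \<mu> f "lam h" h j]) auto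
  qed
  interpret prob_space M by (rule M)
  interpret orig: policy_run \<mu> H K f lam M \<theta> A X
  proof
    show "\<theta> \<in> measurable M (count_space UNIV)" "A k \<in> measurable M (count_space UNIV)" "X k \<in> measurable M \<mu>" for k
      using \<theta>_meas A_meas X_meas by auto
  qed (rule law[rule_format], auto)
  \<comment> \<open>The densities \<open>f h a\<close> need not be measurable for \<open>a \<ge> K\<close>, so out-of-range values, which
    have probability 0, are redefined before posteriors are treated as random variables.\<close>
  define \<theta>' where "\<theta>' \<omega> = (if \<theta> \<omega> < H then \<theta> \<omega> else 0)" for \<omega>
  define A' where "A' k \<omega> = (if A k \<omega> < K then A k \<omega> else 0)" for k \<omega>
  have \<theta>' [measurable]: "\<theta>' \<in> measurable M (count_space UNIV)" unfolding \<theta>'_def by measurable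
  have A' [measurable]: "A' k \<in> measurable M (count_space UNIV)" for k unfolding A'_def by measurable
  have eq: "AE \<omega> in M. \<theta>' \<omega> = \<theta> \<omega> \<and> (\<forall>k. A' k \<omega> = A k \<omega>)"
    using orig.AE_in_range by eventually_elim (auto simp: \<theta>'_def A'_def)
  interpret run: bounded_run \<mu> H K f lam M \<theta>' A' X
  proof
    show "\<theta>' \<in> measurable M (count_space UNIV)" "A' k \<in> measurable M (count_space UNIV)" "X k \<in> measurable M \<mu>" for k
      using \<theta>' A' X_meas by auto
    show "\<theta>' \<omega> < H" "A' k \<omega> < K" for \<omega> k using H_pos K_pos by (auto simp: \<theta>'_def A'_def)
    fix h n :: nat and as :: "nat \<Rightarrow> nat" and Bs :: "nat \<Rightarrow> 'x set"
    assume h: "h < H" and as: "\<And>k. k < n \<Longrightarrow> as k < K" and Bs: "\<And>k. k < n \<Longrightarrow> Bs k \<in> sets \<mu>"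
    have sets: "{\<omega> \<in> space M. T \<omega> = h \<and> (\<forall>k<n. C k \<omega> = as k \<and> X k \<omega> \<in> Bs k)} \<in> sets M"
      if [measurable]: "T \<in> measurable M (count_space UNIV)" "\<And>k. C k \<in> measurable M (count_space UNIV)" for T C
    proof -
      have [measurable]: "Measurable.pred M (\<lambda>\<omega>. X k \<omega> \<in> Bs k)" if "k < n" for k
        using Bs[OF that] by measurable
      have "Measurable.pred M (\<lambda>\<omega>. \<forall>k\<in>{..<n}. C k \<omega> = as k \<and> X k \<omega> \<in> Bs k)"
        by (intro pred_intros_finite) auto
      then have [measurable]: "Measurable.pred M (\<lambda>\<omega>. \<forall>k<n. C k \<omega> = as k \<and> X k \<omega> \<in> Bs k)"
        by (simp add: Ball_def)
      show ?thesis by measurable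
    qed
    have "emeasure M {\<omega> \<in> space M. \<theta>' \<omega> = h \<and> (\<forall>k<n. A' k \<omega> = as k \<and> X k \<omega> \<in> Bs k)} =
        emeasure M {\<omega> \<in> space M. \<theta> \<omega> = h \<and> (\<forall>k<n. A k \<omega> = as k \<and> X k \<omega> \<in> Bs k)}"
    proof (rule emeasure_eq_AE)
      show "AE \<omega> in M. \<omega> \<in> {\<omega> \<in> space M. \<theta>' \<omega> = h \<and> (\<forall>k<n. A' k \<omega> = as k \<and> X k \<omega> \<in> Bs k)} \<longleftrightarrow>
          \<omega> \<in> {\<omega> \<in> space M. \<theta> \<omega> = h \<and> (\<forall>k<n. A k \<omega> = as k \<and> X k \<omega> \<in> Bs k)}"
        using eq by eventually_elim simp
    qed (rule sets[OF \<theta>' A'], rule sets[OF \<theta>_meas A_meas[rule_format]])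
    also have "\<dots> = (\<integral>\<^sup>+ xs. ennreal ((1 / real H) * (\<Prod>k<n. indicator (Bs k) (xs k) *
         lam (argmax_post H (posterior H f k as xs)) (as k) * f h (as k) (xs k))) \<partial>PiM {..<n} (\<lambda>_. \<mu>))"
      using h as Bs by (rule orig.law)
    finally show "emeasure M {\<omega> \<in> space M. \<theta>' \<omega> = h \<and> (\<forall>k<n. A' k \<omega> = as k \<and> X k \<omega> \<in> Bs k)} =
      (\<integral>\<^sup>+ xs. ennreal ((1 / real H) * (\<Prod>k<n. indicator (Bs k) (xs k) *
         lam (argmax_post H (posterior H f k as xs)) (as k) * f h (as k) (xs k))) \<partial>PiM {..<n} (\<lambda>_. \<mu>))" .
  qed
  interpret run: informative_run \<mu> H K f lam M \<theta>' A' X ..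
  interpret run: regular_run \<mu> H K f lam M \<theta>' A' X
    using A3 two by unfold_locales auto
  let ?as = "\<lambda>\<omega> k. A k \<omega>" and ?xs = "\<lambda>\<omega> k. X k \<omega>"
  have as_eq: "AE \<omega> in M. \<theta>' \<omega> = \<theta> \<omega> \<and> (\<lambda>k. A' k \<omega>) = (\<lambda>k. A k \<omega>)"
    using eq by eventually_elim auto
  have error: "measure M {\<omega> \<in> space M. \<not> ((\<exists>n. stop_cond H f \<delta> (?as \<omega>) (?xs \<omega>) n) \<and>
      argmax_post H (posterior H f (stop_time H f \<delta> (?as \<omega>) (?xs \<omega>)) (?as \<omega>) (?xs \<omega>)) = \<theta> \<omega>)} \<le> \<delta>"
    (is "measure M ?E \<le> \<delta>") if \<delta>: "0 < \<delta> \<and> \<delta> < 1" for \<delta>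
  proof (cases "?E \<in> sets M")
    case True
    have "measure M ?E = measure M (run.error_event \<delta>)"
    proof (rule measure_eq_AE)
      show "AE \<omega> in M. \<omega> \<in> ?E \<longleftrightarrow> \<omega> \<in> run.error_event \<delta>"
        using as_eq by eventually_elim (simp add: run.error_event_def)
    qed (use True run.error_event_sets in auto)
    also have "\<dots> \<le> \<delta>" using \<delta> by (intro run.error_probability) auto
    finally show ?thesis .
  next
    \<comment> \<open>a non-measurable set has \<open>measure\<close> 0 by convention\<close>
    case False
    then show ?thesis using \<delta> by (simp add: measure_notin_sets)
  qed
  define E where "E \<delta> = (\<integral>\<^sup>+ \<omega>. (if \<exists>n. stop_cond H f \<delta> (?as \<omega>) (?xs \<omega>) n
      then ennreal (\<Sum>k < stop_time H f \<delta> (?as \<omega>) (?xs \<omega>). c (A k \<omega>)) else \<infinity>) \<partial>M)" for \<delta>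
  have E: "E \<delta> = (\<integral>\<^sup>+ \<omega>. run.run_cost c \<delta> \<omega> \<partial>M)" for \<delta>
    unfolding E_def
  proof (rule nn_integral_cong_AE)
    show "AE \<omega> in M. (if \<exists>n. stop_cond H f \<delta> (?as \<omega>) (?xs \<omega>) n
      then ennreal (\<Sum>k < stop_time H f \<delta> (?as \<omega>) (?xs \<omega>). c (A k \<omega>)) else \<infinity>) = run.run_cost c \<delta> \<omega>"
      using eq as_eq by eventually_elim (simp add: run.run_cost_def)
  qed
  obtain \<alpha> \<beta> where upper: "0 \<le> \<alpha>" "0 \<le> \<beta>" "\<And>\<delta>. 0 < \<delta> \<Longrightarrow> \<delta> < 1 \<Longrightarrow> E \<delta> \<le> ennreal (\<alpha> * ln (1 / \<delta>) + \<beta>)"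
    using run.expected_cost_upper[of c] cost_pos unfolding E by auto
  obtain \<alpha>' \<beta>' where lower: "0 < \<alpha>'" "\<And>\<delta>. 0 < \<delta> \<Longrightarrow> \<delta> < 1 / 2 \<Longrightarrow> ennreal (\<alpha>' * log 2 ((1 - \<delta>) / \<delta>) - \<beta>') \<le> E \<delta>"
    using run.expected_cost_lower[of c] cost_pos unfolding E by auto
  have finite: "E \<delta> < \<infinity>" if "0 < \<delta>" "\<delta> < 1" for \<delta>
    using upper(3)[OF that] by (rule order_le_less_trans) simp
  have "\<forall>\<^sub>F \<delta> in at_right 0. E \<delta> < \<infinity>"
    unfolding eventually_at_right_field using finite by (intro exI[of _ 1]) auto
  moreover have "(\<lambda>\<delta>. enn2real (E \<delta>)) \<in> \<Theta>[at_right 0](\<lambda>\<delta>. ln (1 / \<delta>))"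
  proof (rule bigtheta_log_inverse[OF _ upper(1,2) _ lower(1)])
    fix \<delta> :: real assume \<delta>: "0 < \<delta>" "\<delta> < 1"
    have "enn2real (E \<delta>) \<le> enn2real (ennreal (\<alpha> * ln (1 / \<delta>) + \<beta>))"
      using upper(3)[OF \<delta>] by (intro enn2real_mono) auto
    also have "\<dots> = \<alpha> * ln (1 / \<delta>) + \<beta>"
      using upper \<delta> by (intro enn2real_ennreal add_nonneg_nonneg mult_nonneg_nonneg) auto
    finally show "enn2real (E \<delta>) \<le> \<alpha> * ln (1 / \<delta>) + \<beta>" .
  next
    fix \<delta> :: real assume \<delta>: "0 < \<delta>" "\<delta> < 1 / 2"
    \<comment> \<open>Finiteness makes \<open>enn2real\<close> faithful. The lower bound may be
      negative and is then truncated by \<open>ennreal\<close>; the comparison survives because the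
      other side is nonnegative.\<close>
    have "E \<delta> = ennreal (enn2real (E \<delta>))" using finite[of \<delta>] \<delta> by simp
    with lower(2)[OF \<delta>] have "ennreal (\<alpha>' * log 2 ((1 - \<delta>) / \<delta>) - \<beta>') \<le> ennreal (enn2real (E \<delta>))" by simp
    then show "\<alpha>' * log 2 ((1 - \<delta>) / \<delta>) - \<beta>' \<le> enn2real (E \<delta>)" by (subst (asm) ennreal_le_iff) auto
  qed simp
  ultimately show ?thesis unfolding E_def using error by blast
qed

end
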